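(* The equational theory of integrally closed residuated lattices is a conservative extension of the equational theories of sirmonoids and pseudo BCI-algebras. That is: (1) for all terms $s,t$ in the signature $\{\cdot,\backslash,/,\mathrm{e}\}$, the equation $s\approx t$ is valid in all integrally closed residuated lattices if and only if it is valid in all sirmonoids; and (2) for all terms $s,t$ in the signature $\{\backslash,/,\mathrm{e}\}$, the equation $s\approx t$ is valid in all integrally closed residuated lattices if and only if it is valid in all pseudo BCI-algebras.
   Context: A residuated lattice is an algebra $\langle A,\wedge,\vee,\cdot,\backslash,/,\mathrm{e}\rangle$ such that $\langle A,\wedge,\vee\rangle$ is a lattice, $\langle A,\cdot,\mathrm{e}\rangle$ is a monoid, and for all $a,b,c\in A$: $b\le a\backslash c \iff ab\le c\iff a\le c/b$. It is integrally closed if it satisfies $xy\le x\Rightarrow y\le \mathrm{e}$ and $yx\le x\Rightarrow y\le\mathrm{e}$, or equivalently, $x\backslash x\approx\mathrm{e}$ and $x/x\approx\mathrm{e}$. A residuated pomonoid is a structure $\langle M,\preceq,\cdot,\backslash,/,\mathrm{e}\rangle$ with $\langle M,\cdot,\mathrm{e}\rangle$ a monoid, $\preceq$ a partial order on $M$, and $b\preceq a\backslash c\iff ab\preceq c\iff a\preceq c/b$ for all $a,b,c\in M$. It is semi-integral (a sirmonoid) if $\mathrm{e}$ is a maximal element of $\langle M,\preceq\rangle$, or equivalently, for all $a,b$: $a\preceq b\iff a\backslash b=\mathrm{e}\iff b/a=\mathrm{e}$. A sirmonoid is identified with an algebra $\langle S,\cdot,\backslash,/,\mathrm{e}\rangle$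 of type $\langle 2,2,2,0\rangle$ satisfying: (i) $((x\backslash z)/(y\backslash z))/(x\backslash y)\approx\mathrm{e}$; (ii) $(y/x)\backslash((z/y)\backslash(z/x))\approx\mathrm{e}$; (iii) $\mathrm{e}\backslash x\approx x$; (iv) $x/\mathrm{e}\approx x$; (v) $(x\cdot y)\backslash z\approx y\backslash(x\backslash z)$; (vi) $x\backslash y\approx\mathrm{e}\ \&\ y\backslash x\approx\mathrm{e}\Rightarrow x\approx y$. A pseudo BCI-algebra is an algebra $\langle B,\backslash,/,\mathrm{e}\rangle$ of type $\langle2,2,0\rangle$ satisfying (i)–(iv) and (vi). *)

theory Defs
  imports "HOL-Algebra.Group"
begin

no_notation Order.le (infixl "\<sqsubseteq>\<index>" 50)
no_notation Lattice.meet (infixl "\<sqinter>\<index>" 70)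
no_notation Lattice.join (infixl "\<squnion>\<index>" 65)

text \<open>
  Algebras are records with an explicit carrier.  The signatures extend one another, so an algebra
  for a richer signature is also (with its extra operations ignored) an algebra for a smaller one.
  The carrier is an arbitrary nonempty subset of the type of elements; over an infinite type every
  countable algebra has an isomorphic copy, so such a type is a large enough universe for deciding
  the validity of equations.
\<close>

record 'a div_alg = "'a partial_object" +
  ldiv :: "'a \<Rightarrow> 'a \<Rightarrow> 'a" (infixl "\<setminus>\<index>" 70)
  rdiv :: "'a \<Rightarrow> 'a \<Rightarrow> 'a" (infixl "\<sslash>\<index>" 70)
  unit_elt :: 'a ("\<epsilon>\<index>")

record 'a mult_div_alg = "'a div_alg" +
  prod_op :: "'a \<Rightarrow> 'a \<Rightarrow> 'a" (infixl "\<odot>\<index>" 70)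

record 'a lattice_div_alg = "'a mult_div_alg" +
  meet_op :: "'a \<Rightarrow> 'a \<Rightarrow> 'a" (infixl "\<sqinter>\<index>" 70)
  join_op :: "'a \<Rightarrow> 'a \<Rightarrow> 'a" (infixl "\<squnion>\<index>" 70)

definition lattice_le :: "('a, 'm) lattice_div_alg_scheme \<Rightarrow> 'a \<Rightarrow> 'a \<Rightarrow> bool"
    (infix "\<sqsubseteq>\<index>" 50) where
  "a \<sqsubseteq>\<^bsub>A\<^esub> b \<longleftrightarrow> a \<sqinter>\<^bsub>A\<^esub> b = a"

definition monoid_reduct :: "('a, 'm) mult_div_alg_scheme \<Rightarrow> 'a monoid" where
  "monoid_reduct M = \<lparr>carrier = carrier M, mult = prod_op M, one = unit_elt M\<rparr>"


locale div_algebra =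
  fixes B :: "('a, 'm) div_alg_scheme" (structure)
  assumes ldiv_closed: "\<lbrakk>a \<in> carrier B; b \<in> carrier B\<rbrakk> \<Longrightarrow> a \<setminus> b \<in> carrier B"
    and rdiv_closed: "\<lbrakk>a \<in> carrier B; b \<in> carrier B\<rbrakk> \<Longrightarrow> a \<sslash> b \<in> carrier B"
    and unit_closed: "\<epsilon> \<in> carrier B"

locale pseudo_BCI_algebra = div_algebra +
  assumes ax_i: "\<lbrakk>x \<in> carrier B; y \<in> carrier B; z \<in> carrier B\<rbrakk>
      \<Longrightarrow> ((x \<setminus> z) \<sslash> (y \<setminus> z)) \<sslash> (x \<setminus> y) = \<epsilon>"
    and ax_ii: "\<lbrakk>x \<in> carrier B; y \<in> carrier B; z \<in> carrier B\<rbrakk>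
      \<Longrightarrow> (y \<sslash> x) \<setminus> ((z \<sslash> y) \<setminus> (z \<sslash> x)) = \<epsilon>"
    and ax_iii: "x \<in> carrier B \<Longrightarrow> \<epsilon> \<setminus> x = x"
    and ax_iv: "x \<in> carrier B \<Longrightarrow> x \<sslash> \<epsilon> = x"
    and ax_vi: "\<lbrakk>x \<in> carrier B; y \<in> carrier B; x \<setminus> y = \<epsilon>; y \<setminus> x = \<epsilon>\<rbrakk> \<Longrightarrow> x = y"


locale residuated_pomonoid = div_algebra M
  for M :: "('a, 'm) mult_div_alg_scheme" (structure)
    and le :: "'a \<Rightarrow> 'a \<Rightarrow> bool" (infix "\<preceq>" 50) +
  assumes monoid: "Group.monoid (monoid_reduct M)"
    and le_refl: "reflp_on (carrier M) (\<preceq>)"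
    and le_antisym: "antisymp_on (carrier M) (\<preceq>)"
    and le_trans: "transp_on (carrier M) (\<preceq>)"
    and residuation_left: "\<lbrakk>a \<in> carrier M; b \<in> carrier M; c \<in> carrier M\<rbrakk>
      \<Longrightarrow> b \<preceq> a \<setminus> c \<longleftrightarrow> a \<odot> b \<preceq> c"
    and residuation_right: "\<lbrakk>a \<in> carrier M; b \<in> carrier M; c \<in> carrier M\<rbrakk>
      \<Longrightarrow> a \<odot> b \<preceq> c \<longleftrightarrow> a \<preceq> c \<sslash> b"

locale sirmonoid = residuated_pomonoid +
  assumes unit_maximal: "\<lbrakk>a \<in> carrier M; \<epsilon> \<preceq> a\<rbrakk> \<Longrightarrow> a = \<epsilon>"


locale residuated_lattice = div_algebra A
  for A :: "('a, 'm) lattice_div_alg_scheme" (structure) +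
  assumes monoid: "Group.monoid (monoid_reduct A)"
    and meet_closed: "\<lbrakk>a \<in> carrier A; b \<in> carrier A\<rbrakk> \<Longrightarrow> a \<sqinter> b \<in> carrier A"
    and join_closed: "\<lbrakk>a \<in> carrier A; b \<in> carrier A\<rbrakk> \<Longrightarrow> a \<squnion> b \<in> carrier A"
    and meet_comm: "\<lbrakk>a \<in> carrier A; b \<in> carrier A\<rbrakk> \<Longrightarrow> a \<sqinter> b = b \<sqinter> a"
    and join_comm: "\<lbrakk>a \<in> carrier A; b \<in> carrier A\<rbrakk> \<Longrightarrow> a \<squnion> b = b \<squnion> a"
    and meet_assoc: "\<lbrakk>a \<in> carrier A; b \<in> carrier A; c \<in> carrier A\<rbrakk>
      \<Longrightarrow> (a \<sqinter> b) \<sqinter> c = a \<sqinter> (b \<sqinter> c)"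
    and join_assoc: "\<lbrakk>a \<in> carrier A; b \<in> carrier A; c \<in> carrier A\<rbrakk>
      \<Longrightarrow> (a \<squnion> b) \<squnion> c = a \<squnion> (b \<squnion> c)"
    and meet_join_absorb: "\<lbrakk>a \<in> carrier A; b \<in> carrier A\<rbrakk> \<Longrightarrow> a \<sqinter> (a \<squnion> b) = a"
    and join_meet_absorb: "\<lbrakk>a \<in> carrier A; b \<in> carrier A\<rbrakk> \<Longrightarrow> a \<squnion> (a \<sqinter> b) = a"
    and residuation_left: "\<lbrakk>a \<in> carrier A; b \<in> carrier A; c \<in> carrier A\<rbrakk>
      \<Longrightarrow> b \<sqsubseteq> a \<setminus> c \<longleftrightarrow> a \<odot> b \<sqsubseteq> c"
    and residuation_right: "\<lbrakk>a \<in> carrier A; b \<in> carrier A; c \<in> carrier A\<rbrakk>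
      \<Longrightarrow> a \<odot> b \<sqsubseteq> c \<longleftrightarrow> a \<sqsubseteq> c \<sslash> b"

locale integrally_closed_residuated_lattice = residuated_lattice +
  assumes integrally_closed_right: "\<lbrakk>x \<in> carrier A; y \<in> carrier A; x \<odot> y \<sqsubseteq> x\<rbrakk> \<Longrightarrow> y \<sqsubseteq> \<epsilon>"
    and integrally_closed_left: "\<lbrakk>x \<in> carrier A; y \<in> carrier A; y \<odot> x \<sqsubseteq> x\<rbrakk> \<Longrightarrow> y \<sqsubseteq> \<epsilon>"


text \<open>
  A sirmonoid is a structure with an order, but the order is determined by the operations; this is
  the identification of sirmonoids with the pseudo BCI-algebras that carry a compatible product.
\<close>

lemma (in sirmonoid) le_iff_ldiv:
  assumes "a \<in> carrier M" "b \<in> carrier M"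
  shows "a \<preceq> b \<longleftrightarrow> a \<setminus> b = \<epsilon>"
proof -
  interpret mon: Group.monoid "monoid_reduct M" by (rule monoid)
  have r: "a \<odot> \<epsilon> = a" using mon.r_one[of a] assms by (simp add: monoid_reduct_def)
  have "a \<preceq> b \<longleftrightarrow> \<epsilon> \<preceq> a \<setminus> b"
    using residuation_left[of a \<epsilon> b] assms unit_closed r by simp
  also have "\<dots> \<longleftrightarrow> a \<setminus> b = \<epsilon>"
    using unit_maximal ldiv_closed assms le_refl unit_closed by (metis reflp_onD)
  finally show ?thesis .
qed

lemma (in sirmonoid) le_iff_rdiv:
  assumes "a \<in> carrier M" "b \<in> carrier M"
  shows "a \<preceq> b \<longleftrightarrow> b \<sslash> a = \<epsilon>"
proof -
  interpret mon: Group.monoid "monoid_reduct M" by (rule monoid)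
  have r: "\<epsilon> \<odot> a = a" using mon.l_one[of a] assms by (simp add: monoid_reduct_def)
  have "a \<preceq> b \<longleftrightarrow> \<epsilon> \<preceq> b \<sslash> a"
    using residuation_right[of \<epsilon> a b] assms unit_closed r by simp
  also have "\<dots> \<longleftrightarrow> b \<sslash> a = \<epsilon>"
    using unit_maximal rdiv_closed assms le_refl unit_closed by (metis reflp_onD)
  finally show ?thesis .
qed

lemma (in sirmonoid) prod_closed:
  assumes "a \<in> carrier M" "b \<in> carrier M"
  shows "a \<odot> b \<in> carrier M"
  using monoid.m_closed[OF monoid, of a b] assms by (simp add: monoid_reduct_def)

lemma (in sirmonoid) satisfies_axioms:
  shows "pseudo_BCI_algebra M"
    and "\<lbrakk>x \<in> carrier M; y \<in> carrier M; z \<in> carrier M\<rbrakk> \<Longrightarrow> (x \<odot> y) \<setminus> z = y \<setminus> (x \<setminus> z)"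
proof -
  interpret mon: Group.monoid "monoid_reduct M" by (rule monoid)
  note cl [simp] = ldiv_closed rdiv_closed unit_closed prod_closed
  have r1: "a \<odot> \<epsilon> = a" and l1: "\<epsilon> \<odot> a = a" if "a \<in> carrier M" for a
    using mon.r_one[of a] mon.l_one[of a] that by (simp_all add: monoid_reduct_def)
  have assoc: "(a \<odot> b) \<odot> c = a \<odot> (b \<odot> c)"
    if "a \<in> carrier M" "b \<in> carrier M" "c \<in> carrier M" for a b c
    using mon.m_assoc[of a b c] that by (simp add: monoid_reduct_def)
  have rfl: "a \<preceq> a" if "a \<in> carrier M" for a using le_refl that by (meson reflp_onD)
  have anti: "a = b" if "a \<preceq> b" "b \<preceq> a" "a \<in> carrier M" "b \<in> carrier M" for a b
    using le_antisym that by (meson antisymp_onD)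
  have tr: "a \<preceq> c" if "a \<preceq> b" "b \<preceq> c" "a \<in> carrier M" "b \<in> carrier M" "c \<in> carrier M" for a b c
    using le_trans that by (meson transp_onD)
  have mpl: "a \<odot> (a \<setminus> b) \<preceq> b" if "a \<in> carrier M" "b \<in> carrier M" for a b
    using residuation_left[of a "a \<setminus> b" b] that rfl by simp
  have mpr: "(b \<sslash> a) \<odot> a \<preceq> b" if "a \<in> carrier M" "b \<in> carrier M" for a b
    using residuation_right[of "b \<sslash> a" a b] that rfl by simp
  have monoR: "a \<odot> c \<preceq> b \<odot> c"
    if "a \<preceq> b" "a \<in> carrier M" "b \<in> carrier M" "c \<in> carrier M" for a b c
    using that residuation_right[of a c "b \<odot> c"] residuation_right[of b c "b \<odot> c"]
      rfl[of "b \<odot> c"] tr[of a b "(b \<odot> c) \<sslash> c"] by simp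
  have monoL: "c \<odot> a \<preceq> c \<odot> b"
    if "a \<preceq> b" "a \<in> carrier M" "b \<in> carrier M" "c \<in> carrier M" for a b c
    using that residuation_left[of c a "c \<odot> b"] residuation_left[of c b "c \<odot> b"]
      rfl[of "c \<odot> b"] tr[of a b "c \<setminus> (c \<odot> b)"] by simp
  have ind: "u = w" if "u \<in> carrier M" "w \<in> carrier M"
    "\<And>d. d \<in> carrier M \<Longrightarrow> d \<preceq> u \<longleftrightarrow> d \<preceq> w" for u w
    using that anti rfl by blast
  show v: "(x \<odot> y) \<setminus> z = y \<setminus> (x \<setminus> z)"
    if "x \<in> carrier M" "y \<in> carrier M" "z \<in> carrier M" for x y z
  proof (rule ind)
    fix d assume d: "d \<in> carrier M"
    have "d \<preceq> (x \<odot> y) \<setminus> z \<longleftrightarrow> (x \<odot> y) \<odot> d \<preceq> z" using that d residuation_left by simp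
    also have "\<dots> \<longleftrightarrow> x \<odot> (y \<odot> d) \<preceq> z" using that d assoc by simp
    also have "\<dots> \<longleftrightarrow> d \<preceq> y \<setminus> (x \<setminus> z)" using that d residuation_left by simp
    finally show "d \<preceq> (x \<odot> y) \<setminus> z \<longleftrightarrow> d \<preceq> y \<setminus> (x \<setminus> z)" .
  qed (simp_all add: that)
  show "pseudo_BCI_algebra M"
  proof unfold_locales
    fix x y z assume xyz: "x \<in> carrier M" "y \<in> carrier M" "z \<in> carrier M"
    have "x \<odot> ((x \<setminus> y) \<odot> (y \<setminus> z)) \<preceq> z"
    proof -
      have "(x \<odot> (x \<setminus> y)) \<odot> (y \<setminus> z) \<preceq> y \<odot> (y \<setminus> z)" using xyz mpl monoR by simp
      then show ?thesis using xyz mpl[of y z] assoc[of x "x \<setminus> y" "y \<setminus> z"]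
          tr[of "(x \<odot> (x \<setminus> y)) \<odot> (y \<setminus> z)" "y \<odot> (y \<setminus> z)" z] by simp
    qed
    then have "x \<setminus> y \<preceq> (x \<setminus> z) \<sslash> (y \<setminus> z)"
      using xyz residuation_left[of x "(x \<setminus> y) \<odot> (y \<setminus> z)" z]
        residuation_right[of "x \<setminus> y" "y \<setminus> z" "x \<setminus> z"] by simp
    then show "((x \<setminus> z) \<sslash> (y \<setminus> z)) \<sslash> (x \<setminus> y) = \<epsilon>" using le_iff_rdiv xyz by simp
    have "((z \<sslash> y) \<odot> (y \<sslash> x)) \<odot> x \<preceq> z"
    proof -
      have "(z \<sslash> y) \<odot> ((y \<sslash> x) \<odot> x) \<preceq> (z \<sslash> y) \<odot> y" using xyz mpr monoL by simp
      then show ?thesis using xyz mpr[of y z] assoc[of "z \<sslash> y" "y \<sslash> x" x]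
          tr[of "(z \<sslash> y) \<odot> ((y \<sslash> x) \<odot> x)" "(z \<sslash> y) \<odot> y" z] by simp
    qed
    then have "y \<sslash> x \<preceq> (z \<sslash> y) \<setminus> (z \<sslash> x)"
      using xyz residuation_right[of "(z \<sslash> y) \<odot> (y \<sslash> x)" x z]
        residuation_left[of "z \<sslash> y" "y \<sslash> x" "z \<sslash> x"] by simp
    then show "(y \<sslash> x) \<setminus> ((z \<sslash> y) \<setminus> (z \<sslash> x)) = \<epsilon>" using le_iff_ldiv xyz by simp
  next
    fix x assume x: "x \<in> carrier M"
    show "\<epsilon> \<setminus> x = x"
      by (rule ind) (use x cl l1 residuation_left[of \<epsilon> _ x] in auto)
    show "x \<sslash> \<epsilon> = x"
      by (rule ind) (use x cl r1 residuation_right[of _ \<epsilon> x] in auto)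
  next
    fix x y assume "x \<in> carrier M" "y \<in> carrier M" "x \<setminus> y = \<epsilon>" "y \<setminus> x = \<epsilon>"
    then show "x = y" using le_iff_ldiv anti by blast
  qed
qed

lemma (in pseudo_BCI_algebra) sirmonoidI:
  fixes S :: "('a, 'n) mult_div_alg_scheme"
  assumes carr: "carrier S = carrier B" and ld: "ldiv S = ldiv B" and rd: "rdiv S = rdiv B"
    and un: "unit_elt S = unit_elt B"
    and prod: "\<And>x y. \<lbrakk>x \<in> carrier B; y \<in> carrier B\<rbrakk> \<Longrightarrow> x \<odot>\<^bsub>S\<^esub> y \<in> carrier B"
    and ax_v: "\<And>x y z. \<lbrakk>x \<in> carrier B; y \<in> carrier B; z \<in> carrier B\<rbrakk>
      \<Longrightarrow> (x \<odot>\<^bsub>S\<^esub> y) \<setminus> z = y \<setminus> (x \<setminus> z)"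
  shows "sirmonoid S (\<lambda>a b. a \<setminus> b = \<epsilon>)"
proof -
  note cl [simp] = ldiv_closed rdiv_closed unit_closed prod
  have ldiv_self: "z \<setminus> z = \<epsilon>" if "z \<in> carrier B" for z
    using ax_ii[of \<epsilon> \<epsilon> z] that ax_iii ax_iv by simp
  have lr: "x \<setminus> y = \<epsilon> \<longleftrightarrow> y \<sslash> x = \<epsilon>" if "x \<in> carrier B" "y \<in> carrier B" for x y
    using ax_i[of \<epsilon> x y] ax_ii[of \<epsilon> x y] that ax_iii ax_iv by auto
  have i: "(x \<setminus> y) \<setminus> ((x \<setminus> z) \<sslash> (y \<setminus> z)) = \<epsilon>"
    if "x \<in> carrier B" "y \<in> carrier B" "z \<in> carrier B" for x y z
    using ax_i[of x y z] that lr[of "x \<setminus> y" "(x \<setminus> z) \<sslash> (y \<setminus> z)"] by simp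
  have anti: "(y \<setminus> z) \<setminus> (x \<setminus> z) = \<epsilon>" if "x \<setminus> y = \<epsilon>"
    "x \<in> carrier B" "y \<in> carrier B" "z \<in> carrier B" for x y z
    using ax_i[of x y z] that lr[of "y \<setminus> z" "x \<setminus> z"] ax_iv by simp
  have antir: "(z \<sslash> y) \<setminus> (z \<sslash> x) = \<epsilon>" if "x \<setminus> y = \<epsilon>"
    "x \<in> carrier B" "y \<in> carrier B" "z \<in> carrier B" for x y z
    using ax_ii[of x y z] that lr[of x y] ax_iii by simp
  have tr: "x \<setminus> z = \<epsilon>" if "x \<setminus> y = \<epsilon>" "y \<setminus> z = \<epsilon>"
    "x \<in> carrier B" "y \<in> carrier B" "z \<in> carrier B" for x y z
    using anti[of x y z] that ax_iii by simp
  have mp1: "b \<setminus> ((c \<sslash> b) \<setminus> c) = \<epsilon>" if "b \<in> carrier B" "c \<in> carrier B" for b c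
    using ax_ii[of \<epsilon> b c] that ax_iv by simp
  have mp2: "a \<setminus> (c \<sslash> (a \<setminus> c)) = \<epsilon>" if "a \<in> carrier B" "c \<in> carrier B" for a c
    using i[of \<epsilon> a c] that ax_iii by simp
  have gal: "b \<setminus> (a \<setminus> c) = \<epsilon> \<longleftrightarrow> a \<setminus> (c \<sslash> b) = \<epsilon>"
    if abc: "a \<in> carrier B" "b \<in> carrier B" "c \<in> carrier B" for a b c
  proof (rule iffI)
    assume "b \<setminus> (a \<setminus> c) = \<epsilon>"
    then have "(c \<sslash> (a \<setminus> c)) \<setminus> (c \<sslash> b) = \<epsilon>" using antir[of b "a \<setminus> c" c] abc by simp
    then show "a \<setminus> (c \<sslash> b) = \<epsilon>" using tr[of a "c \<sslash> (a \<setminus> c)" "c \<sslash> b"] mp2 abc by simp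
  next
    assume "a \<setminus> (c \<sslash> b) = \<epsilon>"
    then have "((c \<sslash> b) \<setminus> c) \<setminus> (a \<setminus> c) = \<epsilon>" using anti[of a "c \<sslash> b" c] abc by simp
    then show "b \<setminus> (a \<setminus> c) = \<epsilon>" using tr[of b "(c \<sslash> b) \<setminus> c" "a \<setminus> c"] mp1 abc by simp
  qed
  have ind: "u = w" if "u \<in> carrier B" "w \<in> carrier B"
    "\<And>z. z \<in> carrier B \<Longrightarrow> u \<setminus> z = w \<setminus> z" for u w
  proof (rule ax_vi)
    show "u \<setminus> w = \<epsilon>" unfolding that(3)[OF that(2)] by (rule ldiv_self[OF that(2)])
    show "w \<setminus> u = \<epsilon>"
      unfolding that(3)[OF that(1), symmetric] by (rule ldiv_self[OF that(1)])
  qed (fact that)+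
  have assoc: "x \<odot>\<^bsub>S\<^esub> y \<odot>\<^bsub>S\<^esub> z = x \<odot>\<^bsub>S\<^esub> (y \<odot>\<^bsub>S\<^esub> z)"
    if "x \<in> carrier B" "y \<in> carrier B" "z \<in> carrier B" for x y z
    by (rule ind) (simp_all add: that ax_v)
  have l_one: "\<epsilon> \<odot>\<^bsub>S\<^esub> x = x" if "x \<in> carrier B" for x
    by (rule ind) (simp_all add: that ax_v ax_iii)
  have r_one: "x \<odot>\<^bsub>S\<^esub> \<epsilon> = x" if "x \<in> carrier B" for x
    by (rule ind) (simp_all add: that ax_v ax_iii)
  interpret mon: Group.monoid "monoid_reduct S"
    by (rule monoidI) (simp_all add: monoid_reduct_def carr un assoc l_one r_one)
  show ?thesis
  proof (unfold_locales, unfold carr ld rd un)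
    show "reflp_on (carrier B) (\<lambda>a b. a \<setminus> b = \<epsilon>)" using ldiv_self by (auto intro: reflp_onI)
    show "antisymp_on (carrier B) (\<lambda>a b. a \<setminus> b = \<epsilon>)" using ax_vi by (auto intro: antisymp_onI)
    show "transp_on (carrier B) (\<lambda>a b. a \<setminus> b = \<epsilon>)" using tr by (auto intro: transp_onI)
  next
    fix a b c assume "a \<in> carrier B" "b \<in> carrier B" "c \<in> carrier B"
    then show "b \<setminus> (a \<setminus> c) = \<epsilon> \<longleftrightarrow> (a \<odot>\<^bsub>S\<^esub> b) \<setminus> c = \<epsilon>"
      and "(a \<odot>\<^bsub>S\<^esub> b) \<setminus> c = \<epsilon> \<longleftrightarrow> a \<setminus> (c \<sslash> b) = \<epsilon>"
      using ax_v gal by auto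
  next
    fix a assume "a \<in> carrier B" "\<epsilon> \<setminus> a = \<epsilon>"
    then show "a = \<epsilon>" using ax_iii by simp
  qed simp_all
qed

theorem sirmonoid_iff_algebra:
  fixes S :: "('a, 'm) mult_div_alg_scheme" (structure)
  shows "(\<exists>le. sirmonoid S le) \<longleftrightarrow>
    pseudo_BCI_algebra S \<and>
    (\<forall>x \<in> carrier S. \<forall>y \<in> carrier S. x \<odot> y \<in> carrier S) \<and>
    (\<forall>x \<in> carrier S. \<forall>y \<in> carrier S. \<forall>z \<in> carrier S. (x \<odot> y) \<setminus> z = y \<setminus> (x \<setminus> z))"
  using sirmonoid.satisfies_axioms[of S] sirmonoid.prod_closed[of S]
    pseudo_BCI_algebra.sirmonoidI[of S S]
  by blast


datatype div_term =
    DVar nat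
  | DLdiv div_term div_term
  | DRdiv div_term div_term
  | DUnit

datatype mult_div_term =
    MVar nat
  | MProd mult_div_term mult_div_term
  | MLdiv mult_div_term mult_div_term
  | MRdiv mult_div_term mult_div_term
  | MUnit

primrec eval_div :: "('a, 'm) div_alg_scheme \<Rightarrow> (nat \<Rightarrow> 'a) \<Rightarrow> div_term \<Rightarrow> 'a" where
  "eval_div B v (DVar n) = v n"
| "eval_div B v (DLdiv s t) = eval_div B v s \<setminus>\<^bsub>B\<^esub> eval_div B v t"
| "eval_div B v (DRdiv s t) = eval_div B v s \<sslash>\<^bsub>B\<^esub> eval_div B v t"
| "eval_div B v DUnit = \<epsilon>\<^bsub>B\<^esub>"

primrec eval_mult_div ::
  "('a, 'm) mult_div_alg_scheme \<Rightarrow> (nat \<Rightarrow> 'a) \<Rightarrow> mult_div_term \<Rightarrow> 'a" where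
  "eval_mult_div S v (MVar n) = v n"
| "eval_mult_div S v (MProd s t) = eval_mult_div S v s \<odot>\<^bsub>S\<^esub> eval_mult_div S v t"
| "eval_mult_div S v (MLdiv s t) = eval_mult_div S v s \<setminus>\<^bsub>S\<^esub> eval_mult_div S v t"
| "eval_mult_div S v (MRdiv s t) = eval_mult_div S v s \<sslash>\<^bsub>S\<^esub> eval_mult_div S v t"
| "eval_mult_div S v MUnit = \<epsilon>\<^bsub>S\<^esub>"

definition satisfies_div ::
  "('a, 'm) div_alg_scheme \<Rightarrow> div_term \<Rightarrow> div_term \<Rightarrow> bool" where
  "satisfies_div B s t \<longleftrightarrow>
    (\<forall>v. range v \<subseteq> carrier B \<longrightarrow> eval_div B v s = eval_div B v t)"

definition satisfies_mult_div ::
  "('a, 'm) mult_div_alg_scheme \<Rightarrow> mult_div_term \<Rightarrow> mult_div_term \<Rightarrow> bool" where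
  "satisfies_mult_div S s t \<longleftrightarrow>
    (\<forall>v. range v \<subseteq> carrier S \<longrightarrow> eval_mult_div S v s = eval_mult_div S v t)"

end

theory Submission
  imports Defs "HOL-Library.Countable_Set"
begin

text \<open>
  The sirmonoid and pseudo BCI-algebra reducts of an integrally closed residuated lattice come from
  its greatest group image: an element that is trivial in this image is below the unit.

  Conversely, let \<open>B\<close> be a pseudo BCI-algebra (possibly with a product) with a valuation.  The
  lists over \<open>B\<close>, preordered by \<open>l \<lesssim> l'\<close> iff \<open>l' \<turnstile> c\<close> implies \<open>l \<turnstile> c\<close> for all \<open>c\<close>, form a
  monoid, and the lists trivial in its greatest group image are those below the unit.  Pull the
  grading by this group back to the free group on the variables.  A free group embeds into a
  totally ordered group (Magnus), so the pairs of a degree and a downset of its fiber form, with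
  the lexicographic order, an integrally closed
  residuated lattice, and \<open>b \<mapsto> {l. l \<turnstile> b}\<close> preserves the divisions, the unit and the products that
  exist in \<open>B\<close>.  Hence it refutes every equation that \<open>B\<close> refutes under the valuation, and so does
  a countable subalgebra, which has a copy on any infinite type.
\<close>

text \<open>Why degrees: an integrally closed residuated lattice with a greatest element \<top>
  satisfies \<top> \<odot> \<top> \<sqsubseteq> \<top>, so that \<top> = \<epsilon>, and a least
  element \<bottom> yields the greatest element \<bottom> \<setminus> \<bottom>. The lattice of all
  downsets of lists is bounded and therefore fits only algebras in which every element is below the
  unit. Taking downsets one degree at a time confines such bounds to a single degree, and the
  degrees themselves have no extremal element. Why a free group: a finite group under the discrete
  order is a sirmonoid and its own greatest group image, so this image need not admit a compatible
  total order. The words of degree 0 are those trivial in the free group, and their lists are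
  trivial in the group image under every valuation. The price is that a degree belongs to a term and
  not to its value, so an element may have many degrees.\<close>

section \<open>A bi-ordered group containing a free group\<close>

text \<open>
  The product of formal power series in the noncommuting variables \<open>x\<^sub>0, x\<^sub>1, \<dots>\<close>, a series being
  the function that assigns to a word its coefficient.
\<close>

primrec conv :: "(nat list \<Rightarrow> int) \<Rightarrow> (nat list \<Rightarrow> int) \<Rightarrow> nat list \<Rightarrow> int" where
  conv_Nil: "conv f g [] = f [] * g []"
| conv_Cons: "conv f g (a # w) = f [] * g (a # w) + conv (\<lambda>u. f (a # u)) g w"

text \<open>As a function of \<open>u\<close>, \<open>conv f g (a # u)\<close> has the form
  \<open>c * p u + q u\<close>; this is the induction step of associativity.\<close>

lemma conv_linear_left: "conv (\<lambda>u. c * p u + q u) h w = c * conv p h w + conv q h w"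
  by (induction w arbitrary: p q) (simp_all add: algebra_simps)

lemma conv_assoc: "conv (conv f g) h w = conv f (conv g h) w"
  by (induction w arbitrary: f) (simp_all add: conv_linear_left algebra_simps)

lemma conv_zero_left: "conv (\<lambda>u. 0) h w = 0"
  by (induction w) simp_all

text \<open>The bounds on the length show that \<open>series_inv\<close> below is called only on
  words no longer than the tail, which gives its termination.\<close>

lemma conv_cong [fundef_cong]:
  assumes "w = w'" "\<And>u. length u \<le> length w' \<Longrightarrow> f u = f' u"
    "\<And>u. length u \<le> length w' \<Longrightarrow> g u = g' u"
  shows "conv f g w = conv f' g' w'"
  using assms(2,3) unfolding assms(1) by (induction w' arbitrary: f f') simp_all

definition one_series :: "nat list \<Rightarrow> int" where
  "one_series w = (if w = [] then 1 else 0)"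

lemma conv_one_left: "conv one_series h w = h w"
  by (cases w) (simp_all add: one_series_def conv_zero_left)

lemma conv_one_right: "conv h one_series w = h w"
  by (induction w arbitrary: h) (simp_all add: one_series_def)

text \<open>The equation \<open>conv f h (a # w) = 0\<close> with \<open>f [] = 1\<close>, solved
  for \<open>h (a # w)\<close>.\<close>

function series_inv :: "(nat list \<Rightarrow> int) \<Rightarrow> nat list \<Rightarrow> int" where
  "series_inv f [] = 1"
| "series_inv f (a # w) = - conv (\<lambda>u. f (a # u)) (series_inv f) w"
  by pat_completeness auto
termination by (relation "measure (\<lambda>(f, w). length w)") auto

lemma conv_series_inv_right:
  assumes "f [] = 1"
  shows "conv f (series_inv f) w = one_series w"
  using assms by (cases w) (simp_all add: one_series_def)

typedef magnus = "{f :: nat list \<Rightarrow> int. f [] = 1}"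
  morphisms coeff Abs_magnus
  by (rule exI[of _ one_series]) (simp add: one_series_def)

setup_lifting type_definition_magnus

lemma coeff_Nil [simp]: "coeff g [] = 1"
  using coeff by simp

text \<open>
  The multiplicative group of power series with constant coefficient 1, written additively because
  only \<^class>\<open>group_add\<close> provides noncommutative groups.
\<close>

instantiation magnus :: group_add
begin

lift_definition zero_magnus :: magnus is one_series by (simp add: one_series_def)

lift_definition plus_magnus :: "magnus \<Rightarrow> magnus \<Rightarrow> magnus" is conv by simp

lift_definition uminus_magnus :: "magnus \<Rightarrow> magnus" is series_inv by simp

definition minus_magnus :: "magnus \<Rightarrow> magnus \<Rightarrow> magnus" where
  "minus_magnus a b = a + - b"

instance
proof
  fix a b c :: magnus
  show assoc: "a + b + c = a + (b + c)" for a b c :: magnus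
    by transfer (simp add: fun_eq_iff conv_assoc)
  show zero: "0 + a = a" "a + 0 = a" for a :: magnus
    by (transfer; simp add: fun_eq_iff conv_one_left conv_one_right)+
  have right: "a + - a = 0" for a :: magnus
    by transfer (simp add: fun_eq_iff conv_series_inv_right)
  have "- a + a = - a + (a + (- a + - (- a)))" by (simp add: right zero)
  also have "\<dots> = - a + ((a + - a) + - (- a))" by (simp only: assoc)
  also have "\<dots> = 0" by (simp add: right zero)
  finally show "- a + a = 0" .
qed (simp add: minus_magnus_def)

end

section \<open>A bi-invariant total order on the power series\<close>

lemma conv_diff_left:
  assumes "\<And>u. length u < length w \<Longrightarrow> f u = g u"
  shows "conv f h w - conv g h w = (f w - g w) * h []"
  using assms
proof (induction w arbitrary: f g)
  case (Cons a w)
  have "conv (\<lambda>u. f (a # u)) h w - conv (\<lambda>u. g (a # u)) h w = (f (a # w) - g (a # w)) * h []"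
    by (rule Cons.IH) (simp add: Cons.prems)
  with Cons.prems[of "[]"] show ?case by simp
qed (simp add: algebra_simps)

text \<open>In the sum over the splittings of \<open>w\<close>, only the one with an empty first
  part takes \<open>f\<close> and \<open>g\<close> at a word of full length.
  \<open>conv_diff_left\<close> is the mirror image.\<close>

lemma conv_diff_right:
  assumes "\<And>u. length u < length w \<Longrightarrow> f u = g u"
  shows "conv h f w - conv h g w = h [] * (f w - g w)"
proof (cases w)
  case (Cons a v)
  have "conv (\<lambda>u. h (a # u)) f v = conv (\<lambda>u. h (a # u)) g v"
    by (rule conv_cong) (auto simp: Cons assms)
  then show ?thesis by (simp add: Cons algebra_simps)
qed (simp add: algebra_simps)

lemma coeff_add_diff_right:
  assumes "\<And>u. length u < length w \<Longrightarrow> coeff a u = coeff b u"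
  shows "coeff (a + c) w - coeff (b + c) w = coeff a w - coeff b w"
  using conv_diff_left[of w "coeff a" "coeff b" "coeff c"] assms by (simp add: plus_magnus.rep_eq)

lemma coeff_add_diff_left:
  assumes "\<And>u. length u < length w \<Longrightarrow> coeff a u = coeff b u"
  shows "coeff (c + a) w - coeff (c + b) w = coeff a w - coeff b w"
  using conv_diff_right[of w "coeff a" "coeff b" "coeff c"] assms by (simp add: plus_magnus.rep_eq)

text \<open>
  Series are compared at the first word where they differ.  Shorter words come first, so that
  multiplication by a series with constant coefficient 1 does not change the first difference.
\<close>

abbreviation word_less :: "(nat list \<times> nat list) set" where
  "word_less \<equiv> measures [length, to_nat]"

lemma word_less_trichotomy: "(u, w) \<in> word_less \<or> u = w \<or> (w, u) \<in> word_less"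
  by auto (metis linorder_neq_iff to_nat_split)

lemma word_less_trans: "(u, v) \<in> word_less \<Longrightarrow> (v, w) \<in> word_less \<Longrightarrow> (u, w) \<in> word_less"
  by auto

definition first_less :: "magnus \<Rightarrow> magnus \<Rightarrow> nat list \<Rightarrow> bool" where
  "first_less a b w \<longleftrightarrow>
    coeff a w < coeff b w \<and> (\<forall>u. (u, w) \<in> word_less \<longrightarrow> coeff a u = coeff b u)"

instantiation magnus :: linorder
begin

definition less_magnus :: "magnus \<Rightarrow> magnus \<Rightarrow> bool" where
  "less_magnus a b \<longleftrightarrow> (\<exists>w. first_less a b w)"

definition less_eq_magnus :: "magnus \<Rightarrow> magnus \<Rightarrow> bool" where
  "less_eq_magnus a b \<longleftrightarrow> a < b \<or> a = b"

instance
proof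
  have irrefl: "\<not> a < a" for a :: magnus
    by (simp add: less_magnus_def first_less_def)
  have trans: "a < c" if ab: "a < b" and bc: "b < c" for a b c :: magnus
  proof -
    obtain v w where v: "first_less a b v" and w: "first_less b c w"
      using ab bc by (auto simp: less_magnus_def)
    from word_less_trichotomy[of v w] show ?thesis
    proof (elim disjE)
      assume "(v, w) \<in> word_less"
      then have "first_less a c v"
        using v w word_less_trans unfolding first_less_def by metis
      then show ?thesis by (auto simp: less_magnus_def)
    next
      assume "v = w"
      then have "first_less a c v" using v w by (auto simp: first_less_def)
      then show ?thesis by (auto simp: less_magnus_def)
    next
      assume "(w, v) \<in> word_less"
      then have "first_less a c w"
        using v w word_less_trans unfolding first_less_def by metis
      then show ?thesis by (auto simp: less_magnus_def)
    qed
  qed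
  fix a b c :: magnus
  show "(a < b) = (a \<le> b \<and> \<not> b \<le> a)"
    using irrefl trans by (auto simp: less_eq_magnus_def)
  show "a \<le> a" by (simp add: less_eq_magnus_def)
  show "a \<le> b \<Longrightarrow> b \<le> c \<Longrightarrow> a \<le> c" using trans by (auto simp: less_eq_magnus_def)
  show "a \<le> b \<Longrightarrow> b \<le> a \<Longrightarrow> a = b" using irrefl trans by (auto simp: less_eq_magnus_def)
  show "a \<le> b \<or> b \<le> a"
  proof (cases "a = b")
    case False
    then have "{w. coeff a w \<noteq> coeff b w} \<noteq> {}"
      by (auto simp: coeff_inject[symmetric])
    then obtain w where w: "coeff a w \<noteq> coeff b w"
      and min: "\<And>u. (u, w) \<in> word_less \<Longrightarrow> coeff a u = coeff b u"
      by (rule wfE_min'[OF wf_measures]) blast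
    then have "first_less a b w \<or> first_less b a w"
      by (auto simp: first_less_def)
    then show ?thesis by (auto simp: less_eq_magnus_def less_magnus_def)
  qed (simp add: less_eq_magnus_def)
qed

end

text \<open>Up to the length of the first difference \<open>w\<close>, adding \<open>c\<close>
  changes no difference of coefficients, so \<open>w\<close> remains the first difference and keeps
  its sign. Cancellation is monotonicity for \<open>- c\<close>.\<close>

lemma magnus_add_less_cancel_right:
  fixes a b c :: magnus
  shows "a + c < b + c \<longleftrightarrow> a < b"
proof -
  have mono: "a + c < b + c" if ab: "a < b" for a b c :: magnus
  proof -
    obtain w where w: "first_less a b w" using ab by (auto simp: less_magnus_def)
    have short: "coeff a u = coeff b u" if "length u < length w" for u
      using w that by (simp add: first_less_def)
    have "coeff (a + c) u = coeff (b + c) u" if u: "(u, w) \<in> word_less" for u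
      using coeff_add_diff_right[of u a b c] w u short by (auto simp: first_less_def)
    moreover have "coeff (a + c) w < coeff (b + c) w"
      using coeff_add_diff_right[of w a b c] w short by (auto simp: first_less_def)
    ultimately show ?thesis by (auto simp: less_magnus_def first_less_def)
  qed
  show ?thesis using mono[of a b c] mono[of "a + c" "b + c" "- c"] by (auto simp: add.assoc)
qed

lemma magnus_add_less_cancel_left:
  fixes a b c :: magnus
  shows "c + a < c + b \<longleftrightarrow> a < b"
proof -
  have mono: "c + a < c + b" if ab: "a < b" for a b c :: magnus
  proof -
    obtain w where w: "first_less a b w" using ab by (auto simp: less_magnus_def)
    have short: "coeff a u = coeff b u" if "length u < length w" for u
      using w that by (simp add: first_less_def)
    have "coeff (c + a) u = coeff (c + b) u" if u: "(u, w) \<in> word_less" for u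
      using coeff_add_diff_left[of u a b c] w u short by (auto simp: first_less_def)
    moreover have "coeff (c + a) w < coeff (c + b) w"
      using coeff_add_diff_left[of w a b c] w short by (auto simp: first_less_def)
    ultimately show ?thesis by (auto simp: less_magnus_def first_less_def)
  qed
  show ?thesis using mono[of a b c] mono[of "c + a" "c + b" "- c"] by (auto simp: add.assoc[symmetric])
qed

section \<open>Faithfulness of the Magnus representation of the free group\<close>

lift_definition gen :: "nat \<Rightarrow> magnus" is
  "\<lambda>i w. if w = [] \<or> w = [i] then 1 else 0" by simp

fun letter :: "nat \<times> bool \<Rightarrow> magnus" where
  "letter (i, b) = (if b then gen i else - gen i)"

definition series_val :: "(nat \<times> bool) list \<Rightarrow> magnus" where
  "series_val u = sum_list (map letter u)"

lemma series_val_simps [simp]: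
  "series_val [] = 0" "series_val (x # u) = letter x + series_val u"
  "series_val (u @ v) = series_val u + series_val v"
  by (simp_all add: series_val_def)

definition cancelling :: "nat \<times> bool \<Rightarrow> nat \<times> bool \<Rightarrow> bool" where
  "cancelling x y \<longleftrightarrow> fst x = fst y \<and> snd x \<noteq> snd y"

text \<open>Stands in for the free group, which is never constructed: these are the words that
  represent its neutral element.\<close>

inductive trivial_word :: "(nat \<times> bool) list \<Rightarrow> bool" where
  Nil: "trivial_word []"
| insert: "trivial_word (u @ v) \<Longrightarrow> cancelling x y \<Longrightarrow> trivial_word (u @ x # y # v)"

fun reduced :: "(nat \<times> bool) list \<Rightarrow> bool" where
  "reduced (x # y # u) \<longleftrightarrow> \<not> cancelling x y \<and> reduced (y # u)"
| "reduced _ \<longleftrightarrow> True"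

lemma not_reducedE:
  assumes "\<not> reduced u"
  obtains p x y q where "u = p @ x # y # q" "cancelling x y"
  using assms
proof (induction u arbitrary: thesis rule: reduced.induct)
  case (1 x y u)
  show ?case
  proof (cases "cancelling x y")
    case True
    then show ?thesis using 1(2)[of "[]" x y u] by simp
  next
    case False
    then obtain p x' y' q where "y # u = p @ x' # y' # q" "cancelling x' y'"
      using 1 by (metis reduced.simps(1))
    then show ?thesis using 1(2)[of "x # p" x' y' q] by simp
  qed
qed auto

definition sgn_of :: "bool \<Rightarrow> int" where "sgn_of b = (if b then 1 else -1)"

text \<open>The geometric series for the inverse of \<open>1 + x\<^sub>i\<close>.\<close>

lemma series_inv_gen:
  "series_inv (\<lambda>w. if w = [] \<or> w = [i] then 1 else 0) w =
    (if set w \<subseteq> {i} then (-1) ^ length w else 0)"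
proof (induction w)
  case (Cons a w)
  have "(\<lambda>u. if a # u = [] \<or> a # u = [i] then 1 else 0 :: int) =
      (if a = i then one_series else (\<lambda>u. 0))"
    by (auto simp: one_series_def)
  with Cons show ?case by (simp add: conv_one_left conv_zero_left)
qed simp

lemma coeff_letter_single: "coeff (letter (i, b)) [a] = (if a = i then sgn_of b else 0)"
  by (simp add: gen.rep_eq uminus_magnus.rep_eq series_inv_gen sgn_of_def)

lemma coeff_letter_distinct: "a \<noteq> c \<Longrightarrow> coeff (letter (i, b)) (a # c # w) = 0"
  by (auto simp: gen.rep_eq uminus_magnus.rep_eq series_inv_gen)

text \<open>The series of a letter contains only powers of one variable, so a prefix with two
  distinct adjacent variables contributes nothing. On words without adjacent repetitions each letter
  thus acts like \<open>1 + x\<^sub>i\<close> or \<open>1 - x\<^sub>i\<close>.\<close>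

lemma coeff_letter_add:
  assumes "distinct_adj (a # w)"
  shows "coeff (letter (i, b) + g) (a # w) =
    coeff g (a # w) + (if a = i then sgn_of b * coeff g w else 0)"
proof -
  let ?f = "coeff (letter (i, b))"
  have "conv (\<lambda>u. ?f (a # u)) (coeff g) w = ?f [a] * coeff g w"
  proof (cases w)
    case (Cons c v)
    then have "(\<lambda>u. ?f (a # c # u)) = (\<lambda>u. 0)"
      using assms coeff_letter_distinct by simp
    then show ?thesis by (simp add: Cons conv_zero_left del: letter.simps)
  qed (simp del: letter.simps)
  then show ?thesis
    by (simp add: plus_magnus.rep_eq coeff_letter_single del: letter.simps)
qed

text \<open>
  The coefficient of \<open>x\<^sub>i\<^sub>1 \<dots> x\<^sub>i\<^sub>k\<close> in the value of a word with \<open>k\<close> runs of letters over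
  \<open>i\<^sub>1, \<dots>, i\<^sub>k\<close> is the product of the exponents of these runs.
\<close>

lemma coeff_reduced:
  assumes "reduced ((i, b) # u)"
  shows "\<exists>w c n. distinct_adj (i # w) \<and> c \<noteq> 0 \<and> 0 < n
    \<and> coeff (series_val ((i, b) # u)) w = c
    \<and> coeff (series_val ((i, b) # u)) (i # w) = n * sgn_of b * c
    \<and> (\<forall>z. distinct_adj z \<longrightarrow> length z \<ge> Suc (length w) \<longrightarrow>
         length z > Suc (length w) \<or> hd z \<noteq> i \<longrightarrow> coeff (series_val ((i, b) # u)) z = 0)"
  using assms
proof (induction u arbitrary: i b)
  case Nil
  have z: "coeff 0 (a # w) = 0" for a w by (simp add: zero_magnus.rep_eq one_series_def)
  show ?case
  proof (intro exI conjI allI impI)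
    fix z assume z': "distinct_adj z" "Suc (length []) \<le> length z"
      "Suc (length []) < length z \<or> hd z \<noteq> i"
    then obtain a z'' where "z = a # z''" by (cases z) auto
    then show "coeff (series_val [(i, b)]) z = 0"
      using z' coeff_letter_add[of a z'' i b 0] z by (cases z'') (auto simp del: letter.simps)
  next
    show "coeff (series_val [(i, b)]) [i] = 1 * sgn_of b * 1"
      by (simp add: coeff_letter_single del: letter.simps)
  qed simp_all
next
  case (Cons y u)
  obtain j b' where y: "y = (j, b')" by (cases y)
  let ?g = "series_val ((j, b') # u)"
  have val: "series_val ((i, b) # y # u) = letter (i, b) + ?g" by (simp add: y)
  have red: "reduced ((j, b') # u)" and nc: "i = j \<Longrightarrow> b = b'"
    using Cons.prems by (auto simp: y cancelling_def)
  from Cons.IH[OF red] obtain w c n where alt: "distinct_adj (j # w)" and c: "c \<noteq> 0" "0 < n"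
    and gw: "coeff ?g w = c" and gjw: "coeff ?g (j # w) = n * sgn_of b' * c"
    and van: "\<And>z. distinct_adj z \<Longrightarrow> length z \<ge> Suc (length w) \<Longrightarrow>
         length z > Suc (length w) \<or> hd z \<noteq> j \<Longrightarrow> coeff ?g z = 0"
    by auto
  show ?case
  proof (cases "i = j")
    \<comment> \<open>The first run, of length \<open>n\<close>, becomes longer by one; the later
      runs, which contribute \<open>c\<close> at the word \<open>w\<close>, are unchanged.\<close>
    case True
    then have b: "b = b'" by (rule nc)
    show ?thesis unfolding val
    proof (intro exI conjI allI impI)
      show "distinct_adj (i # w)" using alt True by simp
      show "c \<noteq> 0" "0 < n + 1" using c by auto
      show "coeff (letter (i, b) + ?g) w = c"
      proof (cases w)
        case Nil
        then show ?thesis using gw by simp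
      next
        case (Cons a v)
        then show ?thesis using gw alt True coeff_letter_add[of a v i b ?g] by auto
      qed
      show "coeff (letter (i, b) + ?g) (i # w) = (n + 1) * sgn_of b * c"
        using coeff_letter_add[of i w i b ?g] alt True b gw gjw by (simp add: algebra_simps)
    next
      fix z assume z: "distinct_adj z" "Suc (length w) \<le> length z"
        "Suc (length w) < length z \<or> hd z \<noteq> i"
      then obtain a v where az: "z = a # v" by (cases z) auto
      have "coeff ?g z = 0" using van z True by simp
      moreover have "coeff ?g v = 0" if "a = i"
        using van[of v] z az that True by (cases v) auto
      ultimately show "coeff (letter (i, b) + ?g) z = 0"
        using coeff_letter_add[of a v i b ?g] z az by simp
    qed
  next
    case False
    \<comment> \<open>The letter starts a new run of length 1, and the former leading coefficient
      \<open>n * sgn_of b' * c\<close> becomes the contribution of the later runs.\<close>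
    show ?thesis unfolding val
    proof (intro exI conjI allI impI)
      show "distinct_adj (i # j # w)" using alt False by simp
      show "n * sgn_of b' * c \<noteq> 0" "0 < (1 :: int)" using c by (auto simp: sgn_of_def)
      show "coeff (letter (i, b) + ?g) (j # w) = n * sgn_of b' * c"
        using coeff_letter_add[of j w i b ?g] alt False gjw by simp
      show "coeff (letter (i, b) + ?g) (i # j # w) = 1 * sgn_of b * (n * sgn_of b' * c)"
        using coeff_letter_add[of i "j # w" i b ?g] alt False gjw van[of "i # j # w"] by simp
    next
      fix z assume z: "distinct_adj z" "Suc (length (j # w)) \<le> length z"
        "Suc (length (j # w)) < length z \<or> hd z \<noteq> i"
      then obtain a v where az: "z = a # v" by (cases z) auto
      have "coeff ?g z = 0" using van z by simp
      moreover have "coeff ?g v = 0" if "a = i"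
        using van[of v] z az that by (cases v) auto
      ultimately show "coeff (letter (i, b) + ?g) z = 0"
        using coeff_letter_add[of a v i b ?g] z az by simp
    qed
  qed
qed

lemma letter_cancelling: "cancelling x y \<Longrightarrow> letter x + letter y = 0"
  by (cases x; cases y) (auto simp: cancelling_def)

text \<open>Cancelling pairs are removed, by induction on the length, until the word is reduced. A
  nonempty reduced word has a nonzero coefficient at a nonempty word, so its value is not
  \<open>0\<close>.\<close>

theorem series_val_eq_zero_imp_trivial_word:
  "series_val u = 0 \<Longrightarrow> trivial_word u"
proof (induction "length u" arbitrary: u rule: less_induct)
  case less
  show ?case
  proof (cases "reduced u")
    case True
    show ?thesis
    proof (cases u)
      case (Cons x v)
      obtain i b where x: "x = (i, b)" by (cases x)
      have z: "coeff 0 (a # w) = 0" for a w by (simp add: zero_magnus.rep_eq one_series_def)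
      have "sgn_of b \<noteq> 0" by (simp add: sgn_of_def)
      then have False
        using coeff_reduced[of i b v] True less.prems z by (auto simp: Cons x)
      then show ?thesis ..
    qed (simp add: trivial_word.Nil)
  next
    case False
    then obtain p x y q where u: "u = p @ x # y # q" and xy: "cancelling x y"
      by (rule not_reducedE)
    have "letter x + (letter y + series_val q) = series_val q"
      by (simp add: letter_cancelling[OF xy] add.assoc[symmetric])
    then have "series_val (p @ q) = 0" using less.prems by (simp add: u)
    then have "trivial_word (p @ q)" by (intro less.hyps) (simp_all add: u)
    then show ?thesis unfolding u using xy by (rule trivial_word.insert)
  qed
qed

section \<open>The reducts of integrally closed residuated lattices\<close>

context residuated_lattice
begin

lemma prod_closed [simp]: "\<lbrakk>a \<in> carrier A; b \<in> carrier A\<rbrakk> \<Longrightarrow> a \<odot> b \<in> carrier A"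
  using monoid.m_closed[OF monoid, of a b] by (simp add: monoid_reduct_def)

lemmas closed [simp] = ldiv_closed rdiv_closed unit_closed

lemma prod_assoc:
  "\<lbrakk>a \<in> carrier A; b \<in> carrier A; c \<in> carrier A\<rbrakk> \<Longrightarrow> (a \<odot> b) \<odot> c = a \<odot> (b \<odot> c)"
  using monoid.m_assoc[OF monoid, of a b c] by (simp add: monoid_reduct_def)

lemma prod_unit_right [simp]: "a \<in> carrier A \<Longrightarrow> a \<odot> \<epsilon> = a"
  using monoid.r_one[OF monoid, of a] by (simp add: monoid_reduct_def)

lemma prod_unit_left [simp]: "a \<in> carrier A \<Longrightarrow> \<epsilon> \<odot> a = a"
  using monoid.l_one[OF monoid, of a] by (simp add: monoid_reduct_def)

lemma le_refl [simp]: "a \<in> carrier A \<Longrightarrow> a \<sqsubseteq> a"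
  unfolding lattice_le_def by (metis join_closed meet_join_absorb join_meet_absorb meet_closed)

lemma le_antisym: "\<lbrakk>a \<sqsubseteq> b; b \<sqsubseteq> a; a \<in> carrier A; b \<in> carrier A\<rbrakk> \<Longrightarrow> a = b"
  unfolding lattice_le_def by (metis meet_comm)

lemma le_trans:
  "\<lbrakk>a \<sqsubseteq> b; b \<sqsubseteq> c; a \<in> carrier A; b \<in> carrier A; c \<in> carrier A\<rbrakk> \<Longrightarrow> a \<sqsubseteq> c"
  unfolding lattice_le_def by (metis meet_assoc)

lemma le_ext:
  assumes "a \<in> carrier A" "b \<in> carrier A" "\<And>d. d \<in> carrier A \<Longrightarrow> d \<sqsubseteq> a \<longleftrightarrow> d \<sqsubseteq> b"
  shows "a = b"
  using assms le_antisym le_refl by blast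

lemma ldiv_app: "\<lbrakk>a \<in> carrier A; b \<in> carrier A\<rbrakk> \<Longrightarrow> a \<odot> (a \<setminus> b) \<sqsubseteq> b"
  using residuation_left[of a "a \<setminus> b" b] by simp

lemma rdiv_app: "\<lbrakk>a \<in> carrier A; b \<in> carrier A\<rbrakk> \<Longrightarrow> (b \<sslash> a) \<odot> a \<sqsubseteq> b"
  using residuation_right[of "b \<sslash> a" a b] by simp

lemma prod_mono_left:
  assumes "a \<sqsubseteq> b" "a \<in> carrier A" "b \<in> carrier A" "c \<in> carrier A"
  shows "a \<odot> c \<sqsubseteq> b \<odot> c"
proof -
  have "b \<sqsubseteq> (b \<odot> c) \<sslash> c" using assms residuation_right[of b c "b \<odot> c"] by simp
  then have "a \<sqsubseteq> (b \<odot> c) \<sslash> c" using assms le_trans[of a b] by simp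
  then show ?thesis using assms residuation_right[of a c "b \<odot> c"] by simp
qed

lemma prod_mono_right:
  assumes "a \<sqsubseteq> b" "a \<in> carrier A" "b \<in> carrier A" "c \<in> carrier A"
  shows "c \<odot> a \<sqsubseteq> c \<odot> b"
proof -
  have "b \<sqsubseteq> c \<setminus> (c \<odot> b)" using assms residuation_left[of c b "c \<odot> b"] by simp
  then have "a \<sqsubseteq> c \<setminus> (c \<odot> b)" using assms le_trans[of a b] by simp
  then show ?thesis using assms residuation_left[of c a "c \<odot> b"] by simp
qed

lemma prod_ldiv:
  assumes "x \<in> carrier A" "y \<in> carrier A" "z \<in> carrier A"
  shows "(x \<odot> y) \<setminus> z = y \<setminus> (x \<setminus> z)"
  by (rule le_ext) (simp_all add: assms residuation_left prod_assoc)

lemma rdiv_prod: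
  assumes "x \<in> carrier A" "y \<in> carrier A" "z \<in> carrier A"
  shows "z \<sslash> (x \<odot> y) = (z \<sslash> y) \<sslash> x"
  by (rule le_ext) (simp_all add: assms residuation_right[symmetric] prod_assoc)

lemma unit_ldiv: "x \<in> carrier A \<Longrightarrow> \<epsilon> \<setminus> x = x"
  by (rule le_ext) (simp_all add: residuation_left)

lemma rdiv_unit: "x \<in> carrier A \<Longrightarrow> x \<sslash> \<epsilon> = x"
  by (rule le_ext) (simp_all add: residuation_right[symmetric])

end

context integrally_closed_residuated_lattice
begin

lemma ldiv_self: "x \<in> carrier A \<Longrightarrow> x \<setminus> x = \<epsilon>"
  using integrally_closed_right[of x "x \<setminus> x"] ldiv_app[of x x] residuation_left[of x \<epsilon> x]
  by (intro le_antisym) auto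

lemma rdiv_self: "x \<in> carrier A \<Longrightarrow> x \<sslash> x = \<epsilon>"
  using integrally_closed_left[of x "x \<sslash> x"] rdiv_app[of x x] residuation_right[of \<epsilon> x x]
  by (intro le_antisym) auto

text \<open>Multiplying by \<open>y\<close> on the left gives
  \<open>(y \<odot> x) \<odot> y \<sqsubseteq> y\<close>, from which integral closedness removes the
  factor \<open>y\<close>.\<close>

lemma prod_le_unit_commute:
  assumes "x \<in> carrier A" "y \<in> carrier A" "x \<odot> y \<sqsubseteq> \<epsilon>"
  shows "y \<odot> x \<sqsubseteq> \<epsilon>"
  using integrally_closed_right[of y "x \<odot> y"] integrally_closed_left[of y "y \<odot> x"]
    prod_mono_right[of "x \<odot> y" \<epsilon> y] assms by (simp add: prod_assoc)

lemma ldiv_unit_eq: "x \<in> carrier A \<Longrightarrow> x \<setminus> \<epsilon> = \<epsilon> \<sslash> x"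
  using prod_le_unit_commute
  by (intro le_ext) (simp_all add: residuation_left residuation_right[symmetric], metis)

text \<open>The congruence whose quotient is the greatest group (in fact \<open>\<ell>\<close>-group) image.\<close>

definition group_eq :: "'a \<Rightarrow> 'a \<Rightarrow> bool" (infix "\<approx>" 50) where
  "x \<approx> y \<longleftrightarrow> x \<setminus> \<epsilon> = y \<setminus> \<epsilon>"

lemma group_eq_equiv:
  shows group_eq_refl [simp]: "x \<approx> x"
    and group_eq_sym: "x \<approx> y \<Longrightarrow> y \<approx> x"
    and group_eq_trans [trans]: "x \<approx> y \<Longrightarrow> y \<approx> z \<Longrightarrow> x \<approx> z"
  by (simp_all add: group_eq_def)

lemma group_eq_prod_left:
  assumes "x \<approx> y" "x \<in> carrier A" "y \<in> carrier A" "z \<in> carrier A"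
  shows "z \<odot> x \<approx> z \<odot> y"
  using assms by (simp add: group_eq_def ldiv_unit_eq rdiv_prod)

lemma group_eq_prod_right:
  assumes "x \<approx> y" "x \<in> carrier A" "y \<in> carrier A" "z \<in> carrier A"
  shows "x \<odot> z \<approx> y \<odot> z"
  using assms by (simp add: group_eq_def prod_ldiv)

text \<open>By \<open>rdiv_prod\<close> the negation of this product is
  \<open>(\<epsilon> \<sslash> x) \<sslash> (\<epsilon> \<sslash> x)\<close>, which is the unit by
  \<open>rdiv_self\<close>: integral closedness makes the quotient a group.\<close>

lemma inverse_left: "x \<in> carrier A \<Longrightarrow> (x \<setminus> \<epsilon>) \<odot> x \<approx> \<epsilon>"
  by (simp add: group_eq_def ldiv_unit_eq rdiv_prod rdiv_self rdiv_unit)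

lemma inverse_right: "x \<in> carrier A \<Longrightarrow> x \<odot> (x \<setminus> \<epsilon>) \<approx> \<epsilon>"
  by (simp add: group_eq_def prod_ldiv ldiv_self unit_ldiv)

lemma group_eq_cancel_left:
  assumes "z \<odot> x \<approx> z \<odot> y" "x \<in> carrier A" "y \<in> carrier A" "z \<in> carrier A"
  shows "x \<approx> y"
proof -
  have inv: "(z \<setminus> \<epsilon>) \<odot> (z \<odot> u) \<approx> u" if "u \<in> carrier A" for u
    using group_eq_prod_right[OF inverse_left[of z], of u] assms that by (simp add: prod_assoc)
  have "x \<approx> (z \<setminus> \<epsilon>) \<odot> (z \<odot> x)" by (rule group_eq_sym) (rule inv[OF assms(2)])
  also have "\<dots> \<approx> (z \<setminus> \<epsilon>) \<odot> (z \<odot> y)"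
    by (rule group_eq_prod_left) (simp_all add: assms)
  also have "\<dots> \<approx> y" by (rule inv[OF assms(3)])
  finally show ?thesis .
qed

lemma group_eq_cancel_right:
  assumes "x \<odot> z \<approx> y \<odot> z" "x \<in> carrier A" "y \<in> carrier A" "z \<in> carrier A"
  shows "x \<approx> y"
proof -
  have inv: "(u \<odot> z) \<odot> (z \<setminus> \<epsilon>) \<approx> u" if "u \<in> carrier A" for u
    using group_eq_prod_left[OF inverse_right[of z], of u] assms that by (simp add: prod_assoc)
  have "x \<approx> (x \<odot> z) \<odot> (z \<setminus> \<epsilon>)" by (rule group_eq_sym) (rule inv[OF assms(2)])
  also have "\<dots> \<approx> (y \<odot> z) \<odot> (z \<setminus> \<epsilon>)"
    by (rule group_eq_prod_right) (simp_all add: assms)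
  also have "\<dots> \<approx> y" by (rule inv[OF assms(3)])
  finally show ?thesis .
qed

lemma le_unit_iff: "x \<in> carrier A \<Longrightarrow> x \<sqsubseteq> \<epsilon> \<longleftrightarrow> \<epsilon> \<sqsubseteq> x \<setminus> \<epsilon>"
  by (simp add: residuation_left)

lemma le_unit_cong:
  "\<lbrakk>x \<approx> y; x \<in> carrier A; y \<in> carrier A\<rbrakk> \<Longrightarrow> x \<sqsubseteq> \<epsilon> \<longleftrightarrow> y \<sqsubseteq> \<epsilon>"
  by (simp add: le_unit_iff group_eq_def)

text \<open>The tool for (i) and (ii): an element that is trivial in the group image lies below the
  unit, so it remains to see that it lies above.\<close>

lemma eq_unitI: "\<lbrakk>x \<approx> \<epsilon>; \<epsilon> \<sqsubseteq> x; x \<in> carrier A\<rbrakk> \<Longrightarrow> x = \<epsilon>"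
  using le_unit_cong[of x \<epsilon>] le_antisym by simp

lemma group_eqI:
  assumes "x \<in> carrier A" "y \<in> carrier A"
    "\<And>u. u \<in> carrier A \<Longrightarrow> x \<odot> u \<sqsubseteq> \<epsilon> \<longleftrightarrow> y \<odot> u \<sqsubseteq> \<epsilon>"
  shows "x \<approx> y"
  unfolding group_eq_def by (rule le_ext) (simp_all add: assms residuation_left)

text \<open>In the group image the division becomes that of the group. One implication is
  \<open>ldiv_app\<close>; for the other, \<open>(x \<setminus> \<epsilon>) \<odot> y\<close> lies
  below \<open>x \<setminus> y\<close>, and
  \<open>x \<odot> (x \<setminus> \<epsilon>) \<approx> \<epsilon>\<close>.\<close>

lemma ldiv_app_group_eq:
  assumes "x \<in> carrier A" "y \<in> carrier A"
  shows "x \<odot> (x \<setminus> y) \<approx> y"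
proof (rule group_eqI)
  fix u assume u: "u \<in> carrier A"
  note cl = assms u
  show "x \<odot> (x \<setminus> y) \<odot> u \<sqsubseteq> \<epsilon> \<longleftrightarrow> y \<odot> u \<sqsubseteq> \<epsilon>"
  proof
    assume "y \<odot> u \<sqsubseteq> \<epsilon>"
    moreover have "x \<odot> (x \<setminus> y) \<odot> u \<sqsubseteq> y \<odot> u"
      by (rule prod_mono_left) (simp_all add: cl ldiv_app)
    ultimately show "x \<odot> (x \<setminus> y) \<odot> u \<sqsubseteq> \<epsilon>" using le_trans cl by (meson closed prod_closed)
  next
    assume *: "x \<odot> (x \<setminus> y) \<odot> u \<sqsubseteq> \<epsilon>"
    have "x \<odot> (x \<setminus> \<epsilon>) \<odot> y \<sqsubseteq> \<epsilon> \<odot> y"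
      by (rule prod_mono_left) (simp_all add: cl ldiv_app)
    then have "(x \<setminus> \<epsilon>) \<odot> y \<sqsubseteq> x \<setminus> y"
      by (simp add: cl residuation_left prod_assoc)
    then have "x \<odot> ((x \<setminus> \<epsilon>) \<odot> y) \<odot> u \<sqsubseteq> x \<odot> (x \<setminus> y) \<odot> u"
      by (intro prod_mono_left prod_mono_right) (simp_all add: cl)
    then have "x \<odot> (x \<setminus> \<epsilon>) \<odot> (y \<odot> u) \<sqsubseteq> \<epsilon>"
      using le_trans[OF _ *] by (simp add: cl prod_assoc)
    moreover have "x \<odot> (x \<setminus> \<epsilon>) \<odot> (y \<odot> u) \<approx> \<epsilon> \<odot> (y \<odot> u)"
      by (rule group_eq_prod_right) (simp_all add: cl inverse_right)
    ultimately show "y \<odot> u \<sqsubseteq> \<epsilon>" using le_unit_cong cl by simp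
  qed
qed (simp_all add: assms)

lemma group_eqI':
  assumes "x \<in> carrier A" "y \<in> carrier A"
    "\<And>u. u \<in> carrier A \<Longrightarrow> u \<odot> x \<sqsubseteq> \<epsilon> \<longleftrightarrow> u \<odot> y \<sqsubseteq> \<epsilon>"
  shows "x \<approx> y"
  using assms prod_le_unit_commute by (intro group_eqI) (assumption, assumption, metis)

lemma rdiv_app_group_eq:
  assumes "x \<in> carrier A" "y \<in> carrier A"
  shows "(y \<sslash> x) \<odot> x \<approx> y"
proof (rule group_eqI')
  fix u assume u: "u \<in> carrier A"
  note cl = assms u
  show "u \<odot> ((y \<sslash> x) \<odot> x) \<sqsubseteq> \<epsilon> \<longleftrightarrow> u \<odot> y \<sqsubseteq> \<epsilon>"
  proof
    assume "u \<odot> y \<sqsubseteq> \<epsilon>"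
    moreover have "u \<odot> ((y \<sslash> x) \<odot> x) \<sqsubseteq> u \<odot> y"
      by (rule prod_mono_right) (simp_all add: cl rdiv_app)
    ultimately show "u \<odot> ((y \<sslash> x) \<odot> x) \<sqsubseteq> \<epsilon>" using le_trans cl by (meson closed prod_closed)
  next
    assume *: "u \<odot> ((y \<sslash> x) \<odot> x) \<sqsubseteq> \<epsilon>"
    have "(x \<setminus> \<epsilon>) \<odot> x \<sqsubseteq> \<epsilon>"
      using rdiv_app[of x \<epsilon>] by (simp add: cl ldiv_unit_eq)
    then have "y \<odot> ((x \<setminus> \<epsilon>) \<odot> x) \<sqsubseteq> y \<odot> \<epsilon>"
      by (rule prod_mono_right) (simp_all add: cl)
    then have "y \<odot> (x \<setminus> \<epsilon>) \<sqsubseteq> y \<sslash> x"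
      by (simp add: cl residuation_right[symmetric] prod_assoc)
    then have "u \<odot> ((y \<odot> (x \<setminus> \<epsilon>)) \<odot> x) \<sqsubseteq> u \<odot> ((y \<sslash> x) \<odot> x)"
      by (intro prod_mono_left prod_mono_right) (simp_all add: cl)
    then have "(u \<odot> y) \<odot> ((x \<setminus> \<epsilon>) \<odot> x) \<sqsubseteq> \<epsilon>"
      using le_trans[OF _ *] by (simp add: cl prod_assoc)
    moreover have "(u \<odot> y) \<odot> ((x \<setminus> \<epsilon>) \<odot> x) \<approx> (u \<odot> y) \<odot> \<epsilon>"
      by (rule group_eq_prod_left) (simp_all add: cl inverse_left)
    ultimately show "u \<odot> y \<sqsubseteq> \<epsilon>" using le_unit_cong cl by simp
  qed
qed (simp_all add: assms)

text \<open>The left-hand sides of (i) and (ii), named \<open>w\<close>, lie above the unit in every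
  residuated lattice. In the group image, where the divisions are group divisions, they cancel to
  the unit, and \<open>eq_unitI\<close> applies.\<close>

theorem reduct_pseudo_BCI_algebra: "pseudo_BCI_algebra A"
proof unfold_locales
  fix x y z assume cl: "x \<in> carrier A" "y \<in> carrier A" "z \<in> carrier A"
  define p q r where "p = x \<setminus> z" and "q = y \<setminus> z" and "r = x \<setminus> y"
  define w where "w = (p \<sslash> q) \<sslash> r"
  have cl' [simp]: "p \<in> carrier A" "q \<in> carrier A" "r \<in> carrier A" "w \<in> carrier A"
    by (simp_all add: p_def q_def r_def w_def cl)
  have "x \<odot> (r \<odot> q) \<sqsubseteq> y \<odot> q"
    using prod_mono_left[of "x \<odot> r" y q] ldiv_app[of x y] cl by (simp add: prod_assoc r_def)
  then have "x \<odot> (r \<odot> q) \<sqsubseteq> z"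
    using le_trans[of _ "y \<odot> q" z] ldiv_app[of y z] cl by (simp add: q_def r_def)
  then have "r \<odot> q \<sqsubseteq> p" using residuation_left[of x "r \<odot> q" z] cl by (simp add: p_def)
  then have le: "\<epsilon> \<sqsubseteq> w" unfolding w_def by (simp add: residuation_right[symmetric])
  have "x \<odot> (r \<odot> q) \<approx> y \<odot> q"
    using group_eq_prod_right[OF ldiv_app_group_eq[of x y], of q] cl
    by (simp add: prod_assoc r_def)
  also have "y \<odot> q \<approx> z" using ldiv_app_group_eq[of y z] cl by (simp add: q_def)
  also have "z \<approx> x \<odot> p" using group_eq_sym[OF ldiv_app_group_eq[of x z]] cl by (simp add: p_def)
  finally have rq: "r \<odot> q \<approx> p" by (rule group_eq_cancel_left) (simp_all add: cl)
  have "w \<odot> (r \<odot> q) \<approx> (p \<sslash> q) \<odot> q"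
    using group_eq_prod_right[OF rdiv_app_group_eq[of r "p \<sslash> q"], of q]
    by (simp add: w_def prod_assoc)
  also have "(p \<sslash> q) \<odot> q \<approx> p" by (rule rdiv_app_group_eq) simp_all
  also have "p \<approx> \<epsilon> \<odot> (r \<odot> q)" using group_eq_sym[OF rq] by simp
  finally have "w \<approx> \<epsilon>" by (rule group_eq_cancel_right) simp_all
  then show "((x \<setminus> z) \<sslash> (y \<setminus> z)) \<sslash> (x \<setminus> y) = \<epsilon>"
    using eq_unitI[OF _ le cl'(4)] by (simp add: w_def p_def q_def r_def)
next
  fix x y z assume cl: "x \<in> carrier A" "y \<in> carrier A" "z \<in> carrier A"
  define p q r where "p = z \<sslash> x" and "q = z \<sslash> y" and "r = y \<sslash> x"
  define w where "w = r \<setminus> (q \<setminus> p)"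
  have cl' [simp]: "p \<in> carrier A" "q \<in> carrier A" "r \<in> carrier A" "w \<in> carrier A"
    by (simp_all add: p_def q_def r_def w_def cl)
  have "(q \<odot> r) \<odot> x \<sqsubseteq> q \<odot> y"
    using prod_mono_right[of "r \<odot> x" y q] rdiv_app[of x y] cl by (simp add: prod_assoc r_def)
  then have "(q \<odot> r) \<odot> x \<sqsubseteq> z"
    using le_trans[of _ "q \<odot> y" z] rdiv_app[of y z] cl by (simp add: q_def r_def)
  then have "q \<odot> r \<sqsubseteq> p" using residuation_right[of "q \<odot> r" x z] cl by (simp add: p_def)
  then have le: "\<epsilon> \<sqsubseteq> w" unfolding w_def by (simp add: residuation_left)
  have "(q \<odot> r) \<odot> x \<approx> q \<odot> y"
    using group_eq_prod_left[OF rdiv_app_group_eq[of x y], of q] cl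
    by (simp add: prod_assoc r_def)
  also have "q \<odot> y \<approx> z" using rdiv_app_group_eq[of y z] cl by (simp add: q_def)
  also have "z \<approx> p \<odot> x" using group_eq_sym[OF rdiv_app_group_eq[of x z]] cl by (simp add: p_def)
  finally have qr: "q \<odot> r \<approx> p" by (rule group_eq_cancel_right) (simp_all add: cl)
  have "(q \<odot> r) \<odot> w \<approx> q \<odot> (q \<setminus> p)"
    using group_eq_prod_left[OF ldiv_app_group_eq[of r "q \<setminus> p"], of q]
    by (simp add: w_def prod_assoc)
  also have "q \<odot> (q \<setminus> p) \<approx> p" by (rule ldiv_app_group_eq) simp_all
  also have "p \<approx> (q \<odot> r) \<odot> \<epsilon>" using group_eq_sym[OF qr] by simp
  finally have "w \<approx> \<epsilon>" by (rule group_eq_cancel_left) simp_all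
  then show "(y \<sslash> x) \<setminus> ((z \<sslash> y) \<setminus> (z \<sslash> x)) = \<epsilon>"
    using eq_unitI[OF _ le cl'(4)] by (simp add: w_def p_def q_def r_def)
next
  fix x y assume "x \<in> carrier A" "y \<in> carrier A" "x \<setminus> y = \<epsilon>" "y \<setminus> x = \<epsilon>"
  then show "x = y"
    using residuation_left[of x \<epsilon> y] residuation_left[of y \<epsilon> x] le_antisym by simp
qed (simp_all add: unit_ldiv rdiv_unit)

text \<open>The order is not that of the lattice, in which \<open>\<epsilon>\<close> need not be
  maximal. It is \<open>a \<setminus> b = \<epsilon>\<close>, which amounts to
  \<open>a \<sqsubseteq> b\<close> together with \<open>a \<approx> b\<close>.\<close>

theorem reduct_sirmonoid: "\<exists>le. sirmonoid A le"
  unfolding sirmonoid_iff_algebra using reduct_pseudo_BCI_algebra prod_ldiv by simp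

end

section \<open>Sequents over a pseudo BCI-algebra\<close>

context pseudo_BCI_algebra
begin

lemmas closed [simp] = ldiv_closed rdiv_closed unit_closed

lemma ldiv_self: "z \<in> carrier B \<Longrightarrow> z \<setminus> z = \<epsilon>"
  using ax_ii[of \<epsilon> \<epsilon> z] by (simp add: ax_iii ax_iv)

lemma ldiv_eq_unit_iff:
  assumes "x \<in> carrier B" "y \<in> carrier B"
  shows "x \<setminus> y = \<epsilon> \<longleftrightarrow> y \<sslash> x = \<epsilon>"
  using ax_i[of \<epsilon> x y] ax_ii[of \<epsilon> x y] assms by (auto simp: ax_iii ax_iv)

lemma rdiv_self: "z \<in> carrier B \<Longrightarrow> z \<sslash> z = \<epsilon>"
  using ldiv_self[of z] ldiv_eq_unit_iff[of z z] by simp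

lemma order_trans:
  assumes "x \<setminus> y = \<epsilon>" "y \<setminus> z = \<epsilon>" "x \<in> carrier B" "y \<in> carrier B" "z \<in> carrier B"
  shows "x \<setminus> z = \<epsilon>"
  using ax_i[of x y z] assms ldiv_eq_unit_iff[of \<epsilon> "x \<setminus> z"] by (simp add: ax_iii ax_iv)

lemma ldiv_antimono:
  assumes "x \<setminus> y = \<epsilon>" "x \<in> carrier B" "y \<in> carrier B" "z \<in> carrier B"
  shows "(y \<setminus> z) \<setminus> (x \<setminus> z) = \<epsilon>"
  using ax_i[of x y z] assms ldiv_eq_unit_iff[of "y \<setminus> z" "x \<setminus> z"] by (simp add: ax_iv)

lemma rdiv_antimono:
  assumes "x \<setminus> y = \<epsilon>" "x \<in> carrier B" "y \<in> carrier B" "z \<in> carrier B"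
  shows "(z \<sslash> y) \<setminus> (z \<sslash> x) = \<epsilon>"
  using ax_ii[of x y z] assms ldiv_eq_unit_iff[of x y] by (simp add: ax_iii)

lemma le_rdiv_ldiv: "\<lbrakk>b \<in> carrier B; c \<in> carrier B\<rbrakk> \<Longrightarrow> b \<setminus> ((c \<sslash> b) \<setminus> c) = \<epsilon>"
  using ax_ii[of \<epsilon> b c] by (simp add: ax_iv)

lemma le_ldiv_rdiv: "\<lbrakk>a \<in> carrier B; c \<in> carrier B\<rbrakk> \<Longrightarrow> a \<setminus> (c \<sslash> (a \<setminus> c)) = \<epsilon>"
  using ax_i[of \<epsilon> a c] ldiv_eq_unit_iff[of a "c \<sslash> (a \<setminus> c)"] by (simp add: ax_iii)

lemma le_ldiv_iff_le_rdiv: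
  assumes abc: "a \<in> carrier B" "b \<in> carrier B" "c \<in> carrier B"
  shows "b \<setminus> (a \<setminus> c) = \<epsilon> \<longleftrightarrow> a \<setminus> (c \<sslash> b) = \<epsilon>"
proof
  assume "b \<setminus> (a \<setminus> c) = \<epsilon>"
  then have "(c \<sslash> (a \<setminus> c)) \<setminus> (c \<sslash> b) = \<epsilon>" using rdiv_antimono[of b "a \<setminus> c" c] abc by simp
  then show "a \<setminus> (c \<sslash> b) = \<epsilon>"
    using order_trans[of a "c \<sslash> (a \<setminus> c)" "c \<sslash> b"] le_ldiv_rdiv abc by simp
next
  assume "a \<setminus> (c \<sslash> b) = \<epsilon>"
  then have "((c \<sslash> b) \<setminus> c) \<setminus> (a \<setminus> c) = \<epsilon>" using ldiv_antimono[of a "c \<sslash> b" c] abc by simp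
  then show "b \<setminus> (a \<setminus> c) = \<epsilon>"
    using order_trans[of b "(c \<sslash> b) \<setminus> c" "a \<setminus> c"] le_rdiv_ldiv abc by simp
qed

lemma ldiv_ldiv_le:
  assumes "x \<in> carrier B" "y \<in> carrier B" "z \<in> carrier B"
  shows "(y \<setminus> z) \<setminus> ((x \<setminus> y) \<setminus> (x \<setminus> z)) = \<epsilon>"
  using ax_i[of x y z] le_ldiv_iff_le_rdiv[of "x \<setminus> y" "y \<setminus> z" "x \<setminus> z"] assms
    ldiv_eq_unit_iff[of "x \<setminus> y" "(x \<setminus> z) \<sslash> (y \<setminus> z)"] by simp

lemma ldiv_mono:
  assumes "y \<setminus> z = \<epsilon>" "x \<in> carrier B" "y \<in> carrier B" "z \<in> carrier B"
  shows "(x \<setminus> y) \<setminus> (x \<setminus> z) = \<epsilon>"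
  using ldiv_ldiv_le[of x y z] assms by (simp add: ax_iii)

text \<open>Takes the place of associativity where there is no product: right divisions pass through
  a \<open>fold\<close> of left divisions.\<close>

lemma ldiv_rdiv_exchange:
  assumes abc: "a \<in> carrier B" "b \<in> carrier B" "c \<in> carrier B"
  shows "a \<setminus> (c \<sslash> b) = (a \<setminus> c) \<sslash> b"
proof (rule ax_vi)
  let ?p = "a \<setminus> (c \<sslash> b)" and ?q = "(a \<setminus> c) \<sslash> b"
  have "((c \<sslash> b) \<setminus> c) \<setminus> (?p \<setminus> (a \<setminus> c)) = \<epsilon>" using ldiv_ldiv_le[of a "c \<sslash> b" c] abc by simp
  then have "b \<setminus> (?p \<setminus> (a \<setminus> c)) = \<epsilon>"
    using order_trans[of b "(c \<sslash> b) \<setminus> c" "?p \<setminus> (a \<setminus> c)"] le_rdiv_ldiv abc by simp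
  then show "?p \<setminus> ?q = \<epsilon>" using le_ldiv_iff_le_rdiv[of ?p b "a \<setminus> c"] abc by simp
  have "(c \<sslash> (a \<setminus> c)) \<setminus> ((c \<sslash> b) \<sslash> ?q) = \<epsilon>"
    using ax_ii[of b "a \<setminus> c" c] abc le_ldiv_iff_le_rdiv[of "c \<sslash> (a \<setminus> c)" "?q" "c \<sslash> b"] by simp
  then have "a \<setminus> ((c \<sslash> b) \<sslash> ?q) = \<epsilon>"
    using order_trans[of a "c \<sslash> (a \<setminus> c)" "(c \<sslash> b) \<sslash> ?q"] le_ldiv_rdiv abc by simp
  then show "?q \<setminus> ?p = \<epsilon>" using le_ldiv_iff_le_rdiv[of a ?q "c \<sslash> b"] abc by simp
qed (simp_all add: abc)

text \<open>
  The sequent \<open>x\<^sub>1, \<dots>, x\<^sub>n \<turnstile> b\<close> stands for \<open>x\<^sub>1 \<dots> x\<^sub>n \<le> b\<close>, which by (v) can be said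
  without the product.
\<close>

abbreviation entails :: "'a list \<Rightarrow> 'a \<Rightarrow> bool" (infix "\<turnstile>" 50) where
  "l \<turnstile> b \<equiv> fold (\<setminus>) l b = \<epsilon>"

abbreviation L :: "'a list set" where "L \<equiv> lists (carrier B)"

lemma fold_ldiv_closed [simp]: "\<lbrakk>l \<in> L; b \<in> carrier B\<rbrakk> \<Longrightarrow> fold (\<setminus>) l b \<in> carrier B"
  by (induction l arbitrary: b) auto

lemma fold_ldiv_mono:
  assumes "y \<setminus> z = \<epsilon>" "l \<in> L" "y \<in> carrier B" "z \<in> carrier B"
  shows "fold (\<setminus>) l y \<setminus> fold (\<setminus>) l z = \<epsilon>"
  using assms by (induction l arbitrary: y z) (auto simp: ldiv_mono)

lemma fold_ldiv_rdiv:
  "\<lbrakk>l \<in> L; b \<in> carrier B; c \<in> carrier B\<rbrakk> \<Longrightarrow> fold (\<setminus>) l (c \<sslash> b) = fold (\<setminus>) l c \<sslash> b"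
  by (induction l arbitrary: c) (auto simp: ldiv_rdiv_exchange)

lemma unit_le_iff: "x \<in> carrier B \<Longrightarrow> \<epsilon> \<setminus> x = \<epsilon> \<longleftrightarrow> x = \<epsilon>"
  by (simp add: ax_iii)

lemma entails_trans:
  assumes "l \<turnstile> b" "b \<setminus> c = \<epsilon>" "l \<in> L" "b \<in> carrier B" "c \<in> carrier B"
  shows "l \<turnstile> c"
  using fold_ldiv_mono[of b c l] assms by (simp add: unit_le_iff)

text \<open>\<open>fold\<close> takes a list apart from the front; this does it from the back, as
  monotonicity of appending on the right requires.\<close>

lemma entails_snoc:
  assumes "l \<in> L" "b \<in> carrier B" "c \<in> carrier B"
  shows "l @ [b] \<turnstile> c \<longleftrightarrow> l \<turnstile> c \<sslash> b"
  using assms by (simp add: fold_ldiv_rdiv ldiv_eq_unit_iff)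

definition seq_le :: "'a list \<Rightarrow> 'a list \<Rightarrow> bool" (infix "\<lesssim>" 50) where
  "l \<lesssim> l' \<longleftrightarrow> (\<forall>c \<in> carrier B. l' \<turnstile> c \<longrightarrow> l \<turnstile> c)"

lemma seq_leD: "\<lbrakk>l \<lesssim> m; m \<turnstile> c; c \<in> carrier B\<rbrakk> \<Longrightarrow> l \<turnstile> c"
  by (simp add: seq_le_def)

lemma seq_le_refl [simp]: "l \<lesssim> l" by (simp add: seq_le_def)

lemma seq_le_trans: "l \<lesssim> m \<Longrightarrow> m \<lesssim> n \<Longrightarrow> l \<lesssim> n" by (simp add: seq_le_def)

lemma seq_le_append_left:
  "\<lbrakk>l \<lesssim> l'; u \<in> L\<rbrakk> \<Longrightarrow> u @ l \<lesssim> u @ l'"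
  by (simp add: seq_le_def)

lemma seq_le_append_right:
  assumes "l \<lesssim> l'" "l \<in> L" "l' \<in> L" "u \<in> L"
  shows "l @ u \<lesssim> l' @ u"
  using assms
proof (induction u arbitrary: l l')
  case (Cons x u)
  have "l @ [x] \<lesssim> l' @ [x]"
    unfolding seq_le_def
  proof (intro ballI impI)
    fix c assume c: "c \<in> carrier B" "l' @ [x] \<turnstile> c"
    then have "l' \<turnstile> c \<sslash> x" using entails_snoc Cons.prems by simp
    then have "l \<turnstile> c \<sslash> x" using Cons.prems c by (simp add: seq_le_def)
    then show "l @ [x] \<turnstile> c" using entails_snoc Cons.prems c by simp
  qed
  then show ?case using Cons.IH[of "l @ [x]" "l' @ [x]"] Cons.prems by simp
qed simp

lemma seq_le_append:
  assumes "l \<lesssim> l'" "m \<lesssim> m'" "l \<in> L" "l' \<in> L" "m \<in> L" "m' \<in> L"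
  shows "l @ m \<lesssim> l' @ m'"
  using seq_le_trans[OF seq_le_append_left seq_le_append_right] assms by simp

lemma entails_iff_seq_le:
  assumes "l \<in> L" "b \<in> carrier B"
  shows "l \<turnstile> b \<longleftrightarrow> l \<lesssim> [b]"
  using entails_trans assms by (auto simp: seq_le_def ldiv_self)

lemma entails_unit_iff_seq_le_Nil:
  assumes "l \<in> L"
  shows "l \<turnstile> \<epsilon> \<longleftrightarrow> l \<lesssim> []"
  by (auto simp: seq_le_def)

subsection \<open>The kernel of the greatest group image\<close>

text \<open>An instance of the exchange law, \<open>x \<setminus> (x \<sslash> x) = (x \<setminus>
  x) \<sslash> x\<close>, in which both inner quotients are the unit.\<close>

lemma ldiv_unit_eq: "x \<in> carrier B \<Longrightarrow> x \<setminus> \<epsilon> = \<epsilon> \<sslash> x"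
  using ldiv_rdiv_exchange[of x x x] by (simp add: ldiv_self rdiv_self)

text \<open>Invariance under cyclic shifts is the normality of the kernel. By
  \<open>ldiv_unit_eq\<close> a last letter may be moved to the front.\<close>

lemma kernel_rotate:
  assumes "l \<in> L" "m \<in> L"
  shows "l @ m \<turnstile> \<epsilon> \<longleftrightarrow> m @ l \<turnstile> \<epsilon>"
  using assms
proof (induction m arbitrary: l)
  case (Cons x m)
  have "l @ x # m \<turnstile> \<epsilon> \<longleftrightarrow> (l @ [x]) @ m \<turnstile> \<epsilon>" by simp
  also have "\<dots> \<longleftrightarrow> (m @ l) @ [x] \<turnstile> \<epsilon>" using Cons.IH[of "l @ [x]"] Cons.prems by simp
  also have "\<dots> \<longleftrightarrow> m @ l \<turnstile> x \<setminus> \<epsilon>"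
    using entails_snoc[of "m @ l" x \<epsilon>] Cons.prems ldiv_unit_eq by simp
  also have "\<dots> \<longleftrightarrow> (x # m) @ l \<turnstile> \<epsilon>" by simp
  finally show ?case .
qed simp

lemma kernel_append:
  assumes "l \<in> L" "n \<in> L" "n \<turnstile> \<epsilon>"
  shows "n @ l \<turnstile> \<epsilon> \<longleftrightarrow> l \<turnstile> \<epsilon>"
  using assms by simp

text \<open>The congruence of the monoid of lists whose quotient is the greatest group image of \<open>B\<close>.\<close>

definition seq_eq :: "'a list \<Rightarrow> 'a list \<Rightarrow> bool" (infix "\<sim>" 50) where
  "l \<sim> l' \<longleftrightarrow> (\<forall>p \<in> L. p @ l \<turnstile> \<epsilon> \<longleftrightarrow> p @ l' \<turnstile> \<epsilon>)"

lemma seq_eq_equiv: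
  shows seq_eq_refl [simp]: "l \<sim> l"
    and seq_eq_sym: "l \<sim> m \<Longrightarrow> m \<sim> l"
    and seq_eq_trans [trans]: "l \<sim> m \<Longrightarrow> m \<sim> n \<Longrightarrow> l \<sim> n"
  by (simp_all add: seq_eq_def)

text \<open>Left contexts suffice in the definition of \<open>\<sim>\<close>, because a rotation
  turns a right context into a left one.\<close>

lemma seq_eq_append_right:
  assumes "l \<sim> l'" "l \<in> L" "l' \<in> L" "u \<in> L"
  shows "l @ u \<sim> l' @ u"
  unfolding seq_eq_def
proof
  fix p assume p: "p \<in> L"
  have "p @ m @ u \<turnstile> \<epsilon> \<longleftrightarrow> (u @ p) @ m \<turnstile> \<epsilon>" if "m \<in> L" for m
    using kernel_rotate[of "p @ m" u] p assms that by simp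
  then show "p @ l @ u \<turnstile> \<epsilon> \<longleftrightarrow> p @ l' @ u \<turnstile> \<epsilon>"
    using assms p unfolding seq_eq_def by (metis append_in_lists_conv)
qed

lemma seq_eq_append_left:
  assumes "l \<sim> l'" "u \<in> L"
  shows "u @ l \<sim> u @ l'"
  unfolding seq_eq_def
proof
  fix p assume "p \<in> L"
  then have "(p @ u) @ l \<turnstile> \<epsilon> \<longleftrightarrow> (p @ u) @ l' \<turnstile> \<epsilon>"
    using assms unfolding seq_eq_def by (metis append_in_lists_conv)
  then show "p @ u @ l \<turnstile> \<epsilon> \<longleftrightarrow> p @ u @ l' \<turnstile> \<epsilon>" by simp
qed

lemma seq_eq_append:
  assumes "l \<sim> l'" "m \<sim> m'" "l \<in> L" "l' \<in> L" "m \<in> L" "m' \<in> L"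
  shows "l @ m \<sim> l' @ m'"
  using seq_eq_trans[OF seq_eq_append_left seq_eq_append_right] assms by simp

lemma seq_eq_Nil_iff:
  assumes "l \<in> L"
  shows "l \<sim> [] \<longleftrightarrow> l \<turnstile> \<epsilon>"
proof
  assume "l \<sim> []"
  then show "l \<turnstile> \<epsilon>" unfolding seq_eq_def by (metis append_Nil fold_simps(1) lists.Nil)
next
  assume l: "l \<turnstile> \<epsilon>"
  show "l \<sim> []"
    unfolding seq_eq_def
  proof
    fix p assume "p \<in> L"
    then show "p @ l \<turnstile> \<epsilon> \<longleftrightarrow> p @ [] \<turnstile> \<epsilon>"
      using kernel_rotate[of p l] kernel_append[of p l] assms l by simp
  qed
qed

lemma inverse_right: "x \<in> carrier B \<Longrightarrow> [x, x \<setminus> \<epsilon>] \<sim> []"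
  by (subst seq_eq_Nil_iff) (auto simp: ldiv_self)

lemma inverse_left: "x \<in> carrier B \<Longrightarrow> [x \<setminus> \<epsilon>, x] \<sim> []"
  using kernel_rotate[of "[x]" "[x \<setminus> \<epsilon>]"]
  by (subst seq_eq_Nil_iff) (auto simp: ldiv_self)

text \<open>The group image is ordered discretely. The element \<open>d\<close> is an inverse of
  \<open>l'\<close>, and \<open>l @ [d]\<close>, lying below \<open>l' @ [d]\<close>, is in the
  kernel as well; so \<open>l\<close> and \<open>l'\<close> are inverse to the same element.\<close>

lemma seq_le_imp_seq_eq:
  assumes le: "l \<lesssim> l'" and cl: "l \<in> L" "l' \<in> L"
  shows "l \<sim> l'"
proof -
  define d where "d = fold (\<setminus>) l' \<epsilon>"
  have d: "d \<in> carrier B" using cl by (simp add: d_def)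
  have l'd: "l' @ [d] \<sim> []"
    by (subst seq_eq_Nil_iff) (use cl d in \<open>simp_all add: ldiv_self flip: d_def\<close>)
  have dl': "[d] @ l' \<sim> []"
    using l'd kernel_rotate[of l' "[d]"] cl d by (simp add: seq_eq_Nil_iff)
  have "l @ [d] \<lesssim> l' @ [d]" using le cl d by (intro seq_le_append_right) simp_all
  then have ld: "l @ [d] \<sim> []" using l'd cl d by (simp add: seq_eq_Nil_iff seq_le_def)
  have "l \<sim> l @ ([d] @ l')"
    using seq_eq_append_left[OF dl', of l] cl by (simp add: seq_eq_sym)
  also have "l @ ([d] @ l') \<sim> l'"
    using seq_eq_append_right[OF ld, of l'] cl d by simp
  finally show ?thesis .
qed

end

section \<open>Downsets of a preordered monoid graded over an ordered group\<close>

text \<open>Fibers may overlap and need not cover \<open>L\<close>. The assumption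
  \<open>one_top\<close> is the form that semi-integrality takes here.\<close>

locale graded_preordered_monoid =
  fixes L :: "'b set" and mul :: "'b \<Rightarrow> 'b \<Rightarrow> 'b" (infixl "\<cdot>" 70) and one :: 'b
    and le :: "'b \<Rightarrow> 'b \<Rightarrow> bool" (infix "\<lesssim>" 50) and fiber :: "magnus \<Rightarrow> 'b set"
  assumes assoc: "(x \<cdot> y) \<cdot> z = x \<cdot> (y \<cdot> z)"
    and one_left: "one \<cdot> x = x" and one_right: "x \<cdot> one = x"
    and le_refl: "x \<lesssim> x"
    and le_trans: "x \<lesssim> y \<Longrightarrow> y \<lesssim> z \<Longrightarrow> x \<lesssim> z"
    and mul_mono: "\<lbrakk>x \<lesssim> x'; y \<lesssim> y'; x \<in> L; x' \<in> L; y \<in> L; y' \<in> L\<rbrakk> \<Longrightarrow> x \<cdot> y \<lesssim> x' \<cdot> y'"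
    and fiber_subset: "fiber g \<subseteq> L"
    and fiber_down: "\<lbrakk>x \<lesssim> y; y \<in> fiber g; x \<in> L\<rbrakk> \<Longrightarrow> x \<in> fiber g"
    and fiber_mul: "\<lbrakk>x \<in> fiber g; y \<in> fiber h\<rbrakk> \<Longrightarrow> x \<cdot> y \<in> fiber (g + h)"
    and fiber_one: "one \<in> fiber 0"
    and one_top: "x \<in> fiber 0 \<Longrightarrow> x \<lesssim> one"
begin

text \<open>The empty set is a downset of every degree, since intersections and quotients of
  downsets may be empty.\<close>

definition downsets :: "magnus \<Rightarrow> 'b set set" where
  "downsets g = {C. C \<subseteq> fiber g \<and> (\<forall>x \<in> C. \<forall>y \<in> L. y \<lesssim> x \<longrightarrow> y \<in> C)}"

definition downset_prod :: "'b set \<Rightarrow> 'b set \<Rightarrow> 'b set" where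
  "downset_prod C D = {x \<in> L. \<exists>c \<in> C. \<exists>d \<in> D. x \<lesssim> c \<cdot> d}"

text \<open>
  The order is lexicographic, the first component being the dominant one.  It is integrally closed
  because the fiber of 0 has the unit as its greatest element.
\<close>

definition downset_alg :: "(magnus \<times> 'b set) lattice_div_alg" where
  "downset_alg = \<lparr>
    carrier = {(g, C). C \<in> downsets g},
    ldiv = (\<lambda>(g, C) (h, D). (- g + h, {x \<in> fiber (- g + h). \<forall>c \<in> C. c \<cdot> x \<in> D})),
    rdiv = (\<lambda>(h, D) (g, C). (h - g, {x \<in> fiber (h - g). \<forall>c \<in> C. x \<cdot> c \<in> D})),
    unit_elt = (0, fiber 0),
    prod_op = (\<lambda>(g, C) (h, D). (g + h, downset_prod C D)),
    meet_op = (\<lambda>(g, C) (h, D). if g < h then (g, C) else if h < g then (h, D) else (g, C \<inter> D)),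
    join_op = (\<lambda>(g, C) (h, D). if g < h then (h, D) else if h < g then (g, C) else (g, C \<union> D))\<rparr>"

lemma downset_alg_simps [simp]:
  "x \<in> carrier downset_alg \<longleftrightarrow> snd x \<in> downsets (fst x)"
  "(g, C) \<setminus>\<^bsub>downset_alg\<^esub> (h, D) = (- g + h, {x \<in> fiber (- g + h). \<forall>c \<in> C. c \<cdot> x \<in> D})"
  "(h, D) \<sslash>\<^bsub>downset_alg\<^esub> (g, C) = (h - g, {x \<in> fiber (h - g). \<forall>c \<in> C. x \<cdot> c \<in> D})"
  "\<epsilon>\<^bsub>downset_alg\<^esub> = (0, fiber 0)"
  "(g, C) \<odot>\<^bsub>downset_alg\<^esub> (h, D) = (g + h, downset_prod C D)"
  "(g, C) \<sqinter>\<^bsub>downset_alg\<^esub> (h, D) =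
    (if g < h then (g, C) else if h < g then (h, D) else (g, C \<inter> D))"
  "(g, C) \<squnion>\<^bsub>downset_alg\<^esub> (h, D) =
    (if g < h then (h, D) else if h < g then (g, C) else (g, C \<union> D))"
  by (auto simp: downset_alg_def)

lemma downset_alg_le:
  "(g, C) \<sqsubseteq>\<^bsub>downset_alg\<^esub> (h, D) \<longleftrightarrow> g < h \<or> g = h \<and> C \<subseteq> D"
  by (auto simp: lattice_le_def)

lemma downsetsD: "C \<in> downsets g \<Longrightarrow> C \<subseteq> fiber g" "C \<in> downsets g \<Longrightarrow> C \<subseteq> L"
  "\<lbrakk>C \<in> downsets g; x \<in> C; y \<lesssim> x; y \<in> L\<rbrakk> \<Longrightarrow> y \<in> C"
  using fiber_subset by (auto simp: downsets_def)

lemma mul_closed: "\<lbrakk>x \<in> fiber g; y \<in> fiber h\<rbrakk> \<Longrightarrow> x \<cdot> y \<in> L"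
  using fiber_mul fiber_subset by blast

lemma downset_prod_closed:
  assumes "C \<in> downsets g" "D \<in> downsets h"
  shows "downset_prod C D \<in> downsets (g + h)"
  unfolding downsets_def
proof (intro CollectI conjI ballI impI subsetI)
  fix x assume "x \<in> downset_prod C D"
  then obtain c d where x: "x \<in> L" "c \<in> C" "d \<in> D" "x \<lesssim> c \<cdot> d"
    by (auto simp: downset_prod_def)
  then show "x \<in> fiber (g + h)"
    using fiber_down[of x "c \<cdot> d" "g + h"] fiber_mul[of c g d h] downsetsD(1)[OF assms(1)]
      downsetsD(1)[OF assms(2)] by auto
  fix y assume "y \<in> L" "y \<lesssim> x"
  then show "y \<in> downset_prod C D"
    using x le_trans[of y x "c \<cdot> d"] by (auto simp: downset_prod_def)
qed

lemma downset_prod_subset_iff: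
  assumes "C \<in> downsets g" "D \<in> downsets h" "E \<in> downsets k"
  shows "downset_prod C D \<subseteq> E \<longleftrightarrow> (\<forall>c \<in> C. \<forall>d \<in> D. c \<cdot> d \<in> E)"
proof
  assume *: "downset_prod C D \<subseteq> E"
  show "\<forall>c \<in> C. \<forall>d \<in> D. c \<cdot> d \<in> E"
  proof (intro ballI)
    fix c d assume "c \<in> C" "d \<in> D"
    moreover from this have "c \<cdot> d \<in> L"
      using downsetsD(1)[OF assms(1)] downsetsD(1)[OF assms(2)] mul_closed[of c g d h] by auto
    ultimately show "c \<cdot> d \<in> E" using * le_refl by (auto simp: downset_prod_def)
  qed
next
  assume "\<forall>c \<in> C. \<forall>d \<in> D. c \<cdot> d \<in> E"
  then show "downset_prod C D \<subseteq> E"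
    using downsetsD(3)[OF assms(3)] by (auto simp: downset_prod_def)
qed

text \<open>Both sides are the downset generated by the threefold products.\<close>

lemma downset_prod_assoc:
  assumes "C \<in> downsets g" "D \<in> downsets h" "E \<in> downsets k"
  shows "downset_prod (downset_prod C D) E = downset_prod C (downset_prod D E)"
proof -
  have L: "C \<subseteq> L" "D \<subseteq> L" "E \<subseteq> L" using assms downsetsD by auto
  have m: "c \<cdot> d \<in> L" "d \<cdot> e \<in> L" if "c \<in> C" "d \<in> D" "e \<in> E" for c d e
    using that assms[THEN downsetsD(1)] mul_closed[of c g d h] mul_closed[of d h e k] by auto
  have "x \<in> downset_prod (downset_prod C D) E \<longleftrightarrow>
      x \<in> L \<and> (\<exists>c \<in> C. \<exists>d \<in> D. \<exists>e \<in> E. x \<lesssim> c \<cdot> (d \<cdot> e))" for x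
  proof
    assume "x \<in> downset_prod (downset_prod C D) E"
    then obtain y c d e where "x \<in> L" "y \<in> L" "c \<in> C" "d \<in> D" "e \<in> E" "y \<lesssim> c \<cdot> d" "x \<lesssim> y \<cdot> e"
      by (auto simp: downset_prod_def)
    moreover from this have "y \<cdot> e \<lesssim> (c \<cdot> d) \<cdot> e" using L m le_refl by (intro mul_mono) auto
    ultimately show "x \<in> L \<and> (\<exists>c \<in> C. \<exists>d \<in> D. \<exists>e \<in> E. x \<lesssim> c \<cdot> (d \<cdot> e))"
      using le_trans assoc by metis
  next
    assume "x \<in> L \<and> (\<exists>c \<in> C. \<exists>d \<in> D. \<exists>e \<in> E. x \<lesssim> c \<cdot> (d \<cdot> e))"
    then obtain c d e where x: "x \<in> L" "c \<in> C" "d \<in> D" "e \<in> E" "x \<lesssim> (c \<cdot> d) \<cdot> e"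
      by (auto simp: assoc)
    then have "c \<cdot> d \<in> downset_prod C D"
      using m[OF x(2-4)] le_refl unfolding downset_prod_def by blast
    with x show "x \<in> downset_prod (downset_prod C D) E"
      unfolding downset_prod_def[of _ E] by blast
  qed
  moreover have "x \<in> downset_prod C (downset_prod D E) \<longleftrightarrow>
      x \<in> L \<and> (\<exists>c \<in> C. \<exists>d \<in> D. \<exists>e \<in> E. x \<lesssim> c \<cdot> (d \<cdot> e))" for x
  proof
    assume "x \<in> downset_prod C (downset_prod D E)"
    then obtain y c d e where "x \<in> L" "y \<in> L" "c \<in> C" "d \<in> D" "e \<in> E" "y \<lesssim> d \<cdot> e" "x \<lesssim> c \<cdot> y"
      by (auto simp: downset_prod_def)
    moreover from this have "c \<cdot> y \<lesssim> c \<cdot> (d \<cdot> e)" using L m le_refl by (intro mul_mono) auto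
    ultimately show "x \<in> L \<and> (\<exists>c \<in> C. \<exists>d \<in> D. \<exists>e \<in> E. x \<lesssim> c \<cdot> (d \<cdot> e))"
      using le_trans by metis
  next
    assume "x \<in> L \<and> (\<exists>c \<in> C. \<exists>d \<in> D. \<exists>e \<in> E. x \<lesssim> c \<cdot> (d \<cdot> e))"
    then obtain c d e where x: "x \<in> L" "c \<in> C" "d \<in> D" "e \<in> E" "x \<lesssim> c \<cdot> (d \<cdot> e)"
      by auto
    then have "d \<cdot> e \<in> downset_prod D E"
      using m[OF x(2-4)] le_refl unfolding downset_prod_def by blast
    with x show "x \<in> downset_prod C (downset_prod D E)"
      unfolding downset_prod_def[of C] by blast
  qed
  ultimately show ?thesis by auto
qed

lemma downset_Int: "\<lbrakk>C \<in> downsets g; D \<in> downsets g\<rbrakk> \<Longrightarrow> C \<inter> D \<in> downsets g"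
  and downset_Un: "\<lbrakk>C \<in> downsets g; D \<in> downsets g\<rbrakk> \<Longrightarrow> C \<union> D \<in> downsets g"
  by (auto simp: downsets_def)

lemma fiber_downset: "fiber g \<in> downsets g"
  using fiber_down by (auto simp: downsets_def)

text \<open>By \<open>one_top\<close> the fiber of 0 is the principal downset of
  \<open>one\<close>.\<close>

lemma downset_prod_unit_left:
  assumes C: "C \<in> downsets g"
  shows "downset_prod (fiber 0) C = C"
proof (intro equalityI subsetI)
  fix x assume "x \<in> downset_prod (fiber 0) C"
  then obtain n c where "n \<in> fiber 0" "c \<in> C" "x \<lesssim> n \<cdot> c" "x \<in> L"
    by (auto simp: downset_prod_def)
  moreover from this have "n \<cdot> c \<lesssim> one \<cdot> c"
    using downsetsD(2)[OF C] fiber_subset fiber_one one_top le_refl by (intro mul_mono) auto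
  ultimately show "x \<in> C" using downsetsD(3)[OF C] le_trans one_left by metis
next
  fix x assume "x \<in> C"
  then show "x \<in> downset_prod (fiber 0) C"
    using fiber_one le_refl[of x] downsetsD(2)[OF C] one_left[of x]
    unfolding downset_prod_def by force
qed

lemma downset_prod_unit_right:
  assumes C: "C \<in> downsets g"
  shows "downset_prod C (fiber 0) = C"
proof (intro equalityI subsetI)
  fix x assume "x \<in> downset_prod C (fiber 0)"
  then obtain n c where "n \<in> fiber 0" "c \<in> C" "x \<lesssim> c \<cdot> n" "x \<in> L"
    by (auto simp: downset_prod_def)
  moreover from this have "c \<cdot> n \<lesssim> c \<cdot> one"
    using downsetsD(2)[OF C] fiber_subset fiber_one one_top le_refl by (intro mul_mono) auto
  ultimately show "x \<in> C" using downsetsD(3)[OF C] le_trans one_right by metis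
next
  fix x assume "x \<in> C"
  then show "x \<in> downset_prod C (fiber 0)"
    using fiber_one le_refl[of x] downsetsD(2)[OF C] one_right[of x]
    unfolding downset_prod_def by force
qed

lemma ldiv_downset:
  assumes "C \<in> downsets g" "D \<in> downsets h"
  shows "{x \<in> fiber k. \<forall>c \<in> C. c \<cdot> x \<in> D} \<in> downsets k"
proof -
  have "c \<cdot> y \<in> D" if "x \<in> fiber k" "c \<cdot> x \<in> D" "c \<in> C" "y \<in> L" "y \<lesssim> x" for c x y
  proof -
    have y: "y \<in> fiber k" using fiber_down[of y x k] that by simp
    have c: "c \<in> L" "c \<in> fiber g" using downsetsD(1,2)[OF assms(1)] that by auto
    have "c \<cdot> y \<lesssim> c \<cdot> x" using that c fiber_subset le_refl by (intro mul_mono) auto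
    then show ?thesis
      using downsetsD(3)[OF assms(2) \<open>c \<cdot> x \<in> D\<close>] mul_closed[OF c(2) y] by auto
  qed
  then show ?thesis using fiber_down by (auto simp: downsets_def)
qed

lemma rdiv_downset:
  assumes "C \<in> downsets g" "D \<in> downsets h"
  shows "{x \<in> fiber k. \<forall>c \<in> C. x \<cdot> c \<in> D} \<in> downsets k"
proof -
  have "y \<cdot> c \<in> D" if "x \<in> fiber k" "x \<cdot> c \<in> D" "c \<in> C" "y \<in> L" "y \<lesssim> x" for c x y
  proof -
    have y: "y \<in> fiber k" using fiber_down[of y x k] that by simp
    have c: "c \<in> L" "c \<in> fiber g" using downsetsD(1,2)[OF assms(1)] that by auto
    have "y \<cdot> c \<lesssim> x \<cdot> c" using that c fiber_subset le_refl by (intro mul_mono) auto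
    then show ?thesis
      using downsetsD(3)[OF assms(2) \<open>x \<cdot> c \<in> D\<close>] mul_closed[OF y c(2)] by auto
  qed
  then show ?thesis using fiber_down by (auto simp: downsets_def)
qed

lemma less_ldiv_iff: "h < - g + k \<longleftrightarrow> g + h < k" for g h k :: magnus
  using magnus_add_less_cancel_left[of g h "- g + k"] by (simp add: add.assoc[symmetric])

lemma less_rdiv_iff: "g < k - h \<longleftrightarrow> g + h < k" for g h k :: magnus
  using magnus_add_less_cancel_right[of g h "k - h"] by simp

lemma eq_ldiv_iff: "h = - g + k \<longleftrightarrow> g + h = k" for g h k :: magnus
  by (auto simp: add.assoc[symmetric])

lemma eq_rdiv_iff: "g = k - h \<longleftrightarrow> g + h = k" for g h k :: magnus
  by (simp add: eq_diff_eq)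

theorem downset_alg_integrally_closed: "integrally_closed_residuated_lattice downset_alg"
proof -
  interpret Group.monoid "monoid_reduct downset_alg"
    by (rule monoidI)
      (auto simp: monoid_reduct_def downset_prod_closed downset_prod_assoc fiber_downset add.assoc
        downset_prod_unit_left downset_prod_unit_right)
  show ?thesis
  proof unfold_locales
  fix a b c assume "a \<in> carrier downset_alg" "b \<in> carrier downset_alg" "c \<in> carrier downset_alg"
  then obtain g C h D k E where abc: "a = (g, C)" "b = (h, D)" "c = (k, E)"
    and d: "C \<in> downsets g" "D \<in> downsets h" "E \<in> downsets k"
    by (cases a; cases b; cases c) auto
  note sub = downsetsD(1)[OF d(1)] downsetsD(1)[OF d(2)]
  show "b \<sqsubseteq>\<^bsub>downset_alg\<^esub> a \<setminus>\<^bsub>downset_alg\<^esub> c \<longleftrightarrow> a \<odot>\<^bsub>downset_alg\<^esub> b \<sqsubseteq>\<^bsub>downset_alg\<^esub> c"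
    using sub by (auto simp: abc downset_alg_le downset_prod_subset_iff[OF d] less_ldiv_iff eq_ldiv_iff)
  show "a \<odot>\<^bsub>downset_alg\<^esub> b \<sqsubseteq>\<^bsub>downset_alg\<^esub> c \<longleftrightarrow> a \<sqsubseteq>\<^bsub>downset_alg\<^esub> c \<sslash>\<^bsub>downset_alg\<^esub> b"
    using sub by (auto simp: abc downset_alg_le downset_prod_subset_iff[OF d] less_rdiv_iff eq_rdiv_iff)
next
  fix x y assume "x \<in> carrier downset_alg" "y \<in> carrier downset_alg"
  then obtain g C h D where xy: "x = (g, C)" "y = (h, D)"
    and d: "C \<in> downsets g" "D \<in> downsets h"
    by (cases x; cases y) auto
  \<comment> \<open>Cancelling \<open>g\<close> leaves \<open>h < 0\<close> or \<open>h = 0\<close>.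
    In the second case \<open>D\<close> lies in the fiber of 0, the second component of the unit,
    whatever the inclusion of the second components says.\<close>
  note cancel = magnus_add_less_cancel_left[of g h 0] magnus_add_less_cancel_right[of h g 0]
    add_left_cancel[of g h 0] add_right_cancel[of h g 0]
  show "y \<sqsubseteq>\<^bsub>downset_alg\<^esub> \<epsilon>\<^bsub>downset_alg\<^esub>" if "x \<odot>\<^bsub>downset_alg\<^esub> y \<sqsubseteq>\<^bsub>downset_alg\<^esub> x"
    using that cancel downsetsD(1)[OF d(2)] by (auto simp: xy downset_alg_le)
  show "y \<sqsubseteq>\<^bsub>downset_alg\<^esub> \<epsilon>\<^bsub>downset_alg\<^esub>" if "y \<odot>\<^bsub>downset_alg\<^esub> x \<sqsubseteq>\<^bsub>downset_alg\<^esub> x"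
    using that cancel downsetsD(1)[OF d(2)] by (auto simp: xy downset_alg_le)
qed (auto simp: fiber_downset ldiv_downset rdiv_downset downset_Int downset_Un)
qed

end

section \<open>Lists over a pseudo BCI-algebra as a graded monoid\<close>

locale pseudo_BCI_valuation = pseudo_BCI_algebra +
  fixes v :: "nat \<Rightarrow> 'a"
  assumes val_closed [simp]: "v i \<in> carrier B"
begin

text \<open>Represents the homomorphism from the free group to the group image:
  \<open>v i \<setminus> \<epsilon>\<close> is an inverse of \<open>v i\<close> modulo
  \<open>\<sim>\<close>.\<close>

definition seq_val :: "(nat \<times> bool) list \<Rightarrow> 'a list" where
  "seq_val u = map (\<lambda>(i, b). if b then v i else v i \<setminus> \<epsilon>) u"

lemma seq_val_simps [simp]:
  "seq_val [] = []"
  "seq_val ((i, b) # u) = (if b then v i else v i \<setminus> \<epsilon>) # seq_val u"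
  "seq_val (u @ w) = seq_val u @ seq_val w"
  by (simp_all add: seq_val_def)

lemma seq_val_closed [simp]: "seq_val u \<in> L"
  by (induction u) auto

lemma seq_val_cancelling: "cancelling x y \<Longrightarrow> seq_val [x, y] \<sim> []"
  by (cases x; cases y) (auto simp: cancelling_def inverse_left inverse_right)

lemma seq_val_trivial_word: "trivial_word u \<Longrightarrow> seq_val u \<sim> []"
proof (induction rule: trivial_word.induct)
  case (insert u w x y)
  have "seq_val u @ (seq_val [x, y] @ seq_val w) \<sim> seq_val u @ ([] @ seq_val w)"
    by (intro seq_eq_append seq_eq_append_left seq_eq_append_right seq_val_cancelling insert.hyps) simp_all
  then show ?case using insert.IH seq_eq_trans by (simp flip: seq_val_simps(3))
qed simp

text \<open>A list has a degree for each element of the free group that maps to its group image, and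
  none if the valuation does not generate this image.\<close>

definition fiber :: "magnus \<Rightarrow> 'a list set" where
  "fiber g = {l \<in> L. \<exists>u. series_val u = g \<and> l \<sim> seq_val u}"

lemma fiber_closed: "l \<in> fiber g \<Longrightarrow> l \<in> L"
  by (simp add: fiber_def)

lemma fiber_cong: "\<lbrakk>l \<sim> m; m \<in> fiber g; l \<in> L\<rbrakk> \<Longrightarrow> l \<in> fiber g"
  unfolding fiber_def using seq_eq_trans by blast

lemma fiber_append:
  assumes "l \<in> fiber g" "m \<in> fiber h"
  shows "l @ m \<in> fiber (g + h)"
proof -
  obtain u w where "series_val u = g" "l \<sim> seq_val u" "series_val w = h" "m \<sim> seq_val w"
    "l \<in> L" "m \<in> L"
    using assms by (auto simp: fiber_def)
  then have "series_val (u @ w) = g + h" "l @ m \<sim> seq_val (u @ w)" "l @ m \<in> L"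
    using seq_eq_append[of l "seq_val u" m "seq_val w"] by simp_all
  then show ?thesis unfolding fiber_def by blast
qed

text \<open>Here the faithfulness of the Magnus representation enters: a word of value
  \<open>0\<close> is trivial in the free group, so its list is in the kernel.\<close>

lemma fiber_zero: "fiber 0 = {l \<in> L. l \<turnstile> \<epsilon>}"
proof (intro equalityI subsetI)
  fix l assume "l \<in> fiber 0"
  then obtain u where "series_val u = 0" "l \<sim> seq_val u" "l \<in> L" by (auto simp: fiber_def)
  then have "l \<sim> []"
    using seq_eq_trans seq_val_trivial_word series_val_eq_zero_imp_trivial_word by metis
  then show "l \<in> {l \<in> L. l \<turnstile> \<epsilon>}" using seq_eq_Nil_iff \<open>l \<in> L\<close> by simp
next
  fix l assume "l \<in> {l \<in> L. l \<turnstile> \<epsilon>}"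
  then have "l \<in> L" "l \<sim> seq_val []" "series_val [] = 0" by (auto simp: seq_eq_Nil_iff)
  then show "l \<in> fiber 0" unfolding fiber_def by blast
qed

sublocale graded_preordered_monoid L "(@)" "[]" "(\<lesssim>)" fiber
proof unfold_locales
  fix l m g assume "l \<lesssim> m" "m \<in> fiber g" "l \<in> L"
  then show "l \<in> fiber g" using seq_le_imp_seq_eq fiber_cong fiber_closed by metis
next
  show "fiber g \<subseteq> L" for g using fiber_closed by (rule subsetI)
  show "l \<lesssim> []" if "l \<in> fiber 0" for l
    using that by (auto simp: fiber_zero simp flip: entails_unit_iff_seq_le_Nil)
qed (auto simp: fiber_append fiber_zero intro: seq_le_append seq_le_trans)

fun flip_word :: "(nat \<times> bool) list \<Rightarrow> (nat \<times> bool) list" where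
  "flip_word [] = []"
| "flip_word ((i, b) # u) = flip_word u @ [(i, \<not> b)]"

lemma series_val_flip_word: "series_val (flip_word u) = - series_val u"
  by (induction u rule: flip_word.induct) (auto simp: minus_add)

lemma seq_val_flip_word_left: "seq_val (flip_word u) @ seq_val u \<sim> []"
proof (induction u rule: flip_word.induct)
  case (2 i b u)
  have "seq_val (flip_word u) @ (seq_val [(i, \<not> b), (i, b)] @ seq_val u)
      \<sim> seq_val (flip_word u) @ ([] @ seq_val u)"
    by (intro seq_eq_append_left seq_eq_append_right seq_val_cancelling)
      (simp_all add: cancelling_def)
  then show ?case using 2 seq_eq_trans by (simp flip: seq_val_simps(2,3))
qed simp

lemma seq_val_flip_word_right: "seq_val u @ seq_val (flip_word u) \<sim> []"
  using seq_val_flip_word_left[of u] kernel_rotate[of "seq_val u" "seq_val (flip_word u)"]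
  by (simp add: seq_eq_Nil_iff)

text \<open>Comparable lists have the same group image, so
  \<open>[a, a \<setminus> b] \<lesssim> [b]\<close> determines that of
  \<open>a \<setminus> b\<close>; the formal inverse of a word for \<open>a\<close> then gives the
  degree.\<close>

lemma fiber_ldiv:
  assumes "[a] \<in> fiber g" "[b] \<in> fiber h" "a \<in> carrier B" "b \<in> carrier B"
  shows "[a \<setminus> b] \<in> fiber (- g + h)"
proof -
  obtain u where u: "series_val u = g" "[a] \<sim> seq_val u"
    using assms by (auto simp: fiber_def)
  let ?f = "seq_val (flip_word u)"
  have f: "?f \<in> fiber (- g)"
    unfolding fiber_def using series_val_flip_word u(1) seq_eq_refl seq_val_closed by blast
  have "[a, a \<setminus> b] \<lesssim> [b]"
    using assms ldiv_self by (simp flip: entails_iff_seq_le)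
  then have ab: "[a, a \<setminus> b] \<sim> [b]" using assms by (intro seq_le_imp_seq_eq) simp_all
  have "?f @ seq_val u @ [a \<setminus> b] \<sim> [a \<setminus> b]"
    using seq_eq_append_right[OF seq_val_flip_word_left[of u], of "[a \<setminus> b]"] assms by simp
  then have "[a \<setminus> b] \<sim> ?f @ seq_val u @ [a \<setminus> b]" by (rule seq_eq_sym)
  also have "\<dots> \<sim> ?f @ [a] @ [a \<setminus> b]"
    using u(2) assms by (intro seq_eq_append_left seq_eq_append_right) (simp_all add: seq_eq_sym)
  also have "\<dots> \<sim> ?f @ [b]" using ab by (intro seq_eq_append_left) simp_all
  finally show ?thesis using fiber_cong fiber_append[OF f assms(2)] assms by simp
qed

lemma fiber_rdiv:
  assumes "[a] \<in> fiber g" "[b] \<in> fiber h" "a \<in> carrier B" "b \<in> carrier B"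
  shows "[b \<sslash> a] \<in> fiber (h - g)"
proof -
  obtain u where u: "series_val u = g" "[a] \<sim> seq_val u"
    using assms by (auto simp: fiber_def)
  let ?f = "seq_val (flip_word u)"
  have f: "?f \<in> fiber (- g)"
    unfolding fiber_def using series_val_flip_word u(1) seq_eq_refl seq_val_closed by blast
  have "[b \<sslash> a, a] \<lesssim> [b]"
    using assms entails_snoc[of "[b \<sslash> a]" a b] ldiv_self by (simp flip: entails_iff_seq_le)
  then have ba: "[b \<sslash> a, a] \<sim> [b]" using assms by (intro seq_le_imp_seq_eq) simp_all
  have "[b \<sslash> a] @ seq_val u @ ?f \<sim> [b \<sslash> a]"
    using seq_eq_append_left[OF seq_val_flip_word_right[of u], of "[b \<sslash> a]"] assms by simp
  then have "[b \<sslash> a] \<sim> [b \<sslash> a] @ seq_val u @ ?f" by (rule seq_eq_sym)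
  also have "\<dots> \<sim> [b \<sslash> a] @ [a] @ ?f"
    using u(2) assms by (intro seq_eq_append_left seq_eq_append_right) (simp_all add: seq_eq_sym)
  also have "\<dots> \<sim> [b] @ ?f"
    using seq_eq_append_right[OF ba, of ?f] assms by simp
  finally show ?thesis
    using fiber_cong[OF _ fiber_append[OF assms(2) f]] assms by simp
qed

definition principal :: "'a \<Rightarrow> 'a list set" where
  "principal b = {l \<in> L. l \<turnstile> b}"

lemma principal_iff: "b \<in> carrier B \<Longrightarrow> l \<in> principal b \<longleftrightarrow> l \<in> L \<and> l \<lesssim> [b]"
  unfolding principal_def using entails_iff_seq_le[of l b] by blast

lemma principal_downset:
  assumes "[b] \<in> fiber g" "b \<in> carrier B"
  shows "principal b \<in> downsets g"
  using assms fiber_down[OF _ assms(1)] entails_iff_seq_le[OF _ assms(2)] seq_le_trans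
  unfolding downsets_def principal_def by blast

lemma single_in_principal: "b \<in> carrier B \<Longrightarrow> [b] \<in> principal b"
  by (simp add: principal_def ldiv_self)

lemma principal_inject:
  assumes "principal a = principal b" "a \<in> carrier B" "b \<in> carrier B"
  shows "a = b"
proof (rule ax_vi[OF assms(2,3)])
  have "[a] \<in> principal b" "[b] \<in> principal a"
    using single_in_principal assms by auto
  then show "a \<setminus> b = \<epsilon>" "b \<setminus> a = \<epsilon>" by (simp_all add: principal_def)
qed

text \<open>The condition need only be tested at the greatest element \<open>[a]\<close> of
  \<open>principal a\<close>, and \<open>[a] @ x \<turnstile> b\<close> is
  \<open>x \<turnstile> a \<setminus> b\<close> by definition of \<open>fold\<close>.\<close>

lemma principal_ldiv:
  assumes "[a] \<in> fiber g" "[b] \<in> fiber h" "a \<in> carrier B" "b \<in> carrier B"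
  shows "{x \<in> fiber (- g + h). \<forall>c \<in> principal a. c @ x \<in> principal b} = principal (a \<setminus> b)"
proof (intro equalityI subsetI)
  fix x assume "x \<in> {x \<in> fiber (- g + h). \<forall>c \<in> principal a. c @ x \<in> principal b}"
  then have "[a] @ x \<in> principal b" "x \<in> L"
    using single_in_principal[of a] assms fiber_closed by blast+
  then show "x \<in> principal (a \<setminus> b)" by (simp add: principal_def)
next
  fix x assume x: "x \<in> principal (a \<setminus> b)"
  then have "x \<in> fiber (- g + h)"
    using principal_downset[OF fiber_ldiv[OF assms]] assms downsetsD(1) by auto
  moreover have "c @ x \<in> principal b" if c: "c \<in> principal a" for c
  proof -
    have "[a] @ x \<turnstile> b" using x by (simp add: principal_def)
    moreover have "c @ x \<lesssim> [a] @ x"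
      using c x assms(3,4) by (intro seq_le_append_right) (simp_all add: principal_iff)
    ultimately show ?thesis using seq_leD[of "c @ x" "[a] @ x" b] c x assms by (simp add: principal_def)
  qed
  ultimately show "x \<in> {x \<in> fiber (- g + h). \<forall>c \<in> principal a. c @ x \<in> principal b}" by simp
qed

lemma principal_rdiv:
  assumes "[a] \<in> fiber g" "[b] \<in> fiber h" "a \<in> carrier B" "b \<in> carrier B"
  shows "{x \<in> fiber (h - g). \<forall>c \<in> principal a. x @ c \<in> principal b} = principal (b \<sslash> a)"
proof (intro equalityI subsetI)
  fix x assume "x \<in> {x \<in> fiber (h - g). \<forall>c \<in> principal a. x @ c \<in> principal b}"
  then have "x @ [a] \<in> principal b" "x \<in> L"
    using single_in_principal[of a] assms fiber_closed by blast+
  then show "x \<in> principal (b \<sslash> a)"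
    using entails_snoc[of x a b] assms by (simp add: principal_def)
next
  fix x assume x: "x \<in> principal (b \<sslash> a)"
  then have "x \<in> fiber (h - g)"
    using principal_downset[OF fiber_rdiv[OF assms]] assms downsetsD(1) by auto
  moreover have "x @ c \<in> principal b" if c: "c \<in> principal a" for c
  proof -
    have "x @ [a] \<turnstile> b" using x entails_snoc[of x a b] assms by (simp add: principal_def)
    moreover have "x @ c \<lesssim> x @ [a]"
      using c x assms(3,4) by (intro seq_le_append_left) (simp_all add: principal_iff)
    ultimately show ?thesis
      using seq_leD[of "x @ c" "x @ [a]" b] c x assms by (simp add: principal_def)
  qed
  ultimately show "x \<in> {x \<in> fiber (h - g). \<forall>c \<in> principal a. x @ c \<in> principal b}" by simp
qed

text \<open>The last hypothesis is (v) for one product \<open>p\<close> of \<open>a\<close> and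
  \<open>b\<close>. It makes \<open>[p]\<close> and \<open>[a, b]\<close> equivalent in the
  preorder, so they generate the same downset.\<close>

lemma principal_prod:
  assumes "a \<in> carrier B" "b \<in> carrier B" "p \<in> carrier B"
    and p: "\<And>z. z \<in> carrier B \<Longrightarrow> p \<setminus> z = b \<setminus> (a \<setminus> z)"
  shows "downset_prod (principal a) (principal b) = principal p"
proof (intro equalityI subsetI)
  have p_ab: "[p] \<lesssim> [a, b]" "[a, b] \<lesssim> [p]" by (auto simp: seq_le_def p)
  {
    fix x assume "x \<in> downset_prod (principal a) (principal b)"
    then obtain c d where x: "x \<in> L" "x \<lesssim> c @ d" "c \<in> L" "d \<in> L" "c \<lesssim> [a]" "d \<lesssim> [b]"
      unfolding downset_prod_def principal_def using assms(1,2) entails_iff_seq_le by blast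
    then have "c @ d \<lesssim> [a, b]" using seq_le_append[of c "[a]" d "[b]"] assms by simp
    then have "x \<lesssim> [p]" using seq_le_trans[OF x(2)] seq_le_trans[OF _ p_ab(2)] by simp
    then show "x \<in> principal p" using x(1) assms by (simp add: principal_iff)
  next
    fix x assume "x \<in> principal p"
    then have "x \<in> L" "x \<lesssim> [a] @ [b]"
      using seq_le_trans[OF _ p_ab(1)] assms by (auto simp: principal_iff)
    then show "x \<in> downset_prod (principal a) (principal b)"
      unfolding downset_prod_def using single_in_principal assms by blast
  }
qed

section \<open>Evaluation of terms in the algebra of downsets\<close>

definition point :: "nat \<Rightarrow> magnus \<times> 'a list set" where
  "point i = (gen i, principal (v i))"

lemma fiber_gen: "[v i] \<in> fiber (gen i)"
  unfolding fiber_def by (auto intro!: exI[of _ "[(i, True)]"])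

lemma point_closed: "range point \<subseteq> carrier downset_alg"
  using fiber_gen principal_downset by (auto simp: point_def)

lemma principal_unit: "fiber 0 = principal \<epsilon>"
  by (simp add: fiber_zero principal_def)

lemma eval_div_closed [simp]: "eval_div B v t \<in> carrier B"
  by (induction t) simp_all

text \<open>The degree \<open>g\<close> may differ between terms of equal value. This does no harm:
  equal pairs have equal second components, and these determine the values in
  \<open>B\<close>.\<close>

lemma eval_div_downset_alg:
  "\<exists>g. eval_div downset_alg point t = (g, principal (eval_div B v t)) \<and> [eval_div B v t] \<in> fiber g"
proof (induction t)
  case (DLdiv s t)
  then show ?case using fiber_ldiv principal_ldiv by fastforce
next
  case (DRdiv s t)
  then show ?case using fiber_rdiv principal_rdiv by fastforce
qed (auto simp: point_def fiber_gen principal_unit single_in_principal)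

lemma eval_div_downset_alg_inject:
  "eval_div downset_alg point s = eval_div downset_alg point t \<Longrightarrow> eval_div B v s = eval_div B v t"
  using eval_div_downset_alg[of s] eval_div_downset_alg[of t] principal_inject by auto

end

locale sirmonoid_valuation = pseudo_BCI_valuation B v
  for B :: "('a, 'm) mult_div_alg_scheme" (structure) and v +
  assumes prod_closed [simp]: "\<lbrakk>x \<in> carrier B; y \<in> carrier B\<rbrakk> \<Longrightarrow> x \<odot> y \<in> carrier B"
    and ax_v: "\<lbrakk>x \<in> carrier B; y \<in> carrier B; z \<in> carrier B\<rbrakk>
      \<Longrightarrow> (x \<odot> y) \<setminus> z = y \<setminus> (x \<setminus> z)"
begin

lemma fiber_prod:
  assumes "[a] \<in> fiber g" "[b] \<in> fiber h" "a \<in> carrier B" "b \<in> carrier B"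
  shows "[a \<odot> b] \<in> fiber (g + h)"
  using fiber_down[OF _ fiber_append[OF assms(1,2)], of "[a \<odot> b]"] assms
  by (simp add: seq_le_def ax_v)

lemma eval_mult_div_closed [simp]: "eval_mult_div B v t \<in> carrier B"
  by (induction t) simp_all

lemma eval_mult_div_downset_alg:
  "\<exists>g. eval_mult_div downset_alg point t = (g, principal (eval_mult_div B v t)) \<and>
    [eval_mult_div B v t] \<in> fiber g"
proof (induction t)
  case (MProd s t)
  then show ?case using fiber_prod principal_prod ax_v by fastforce
next
  case (MLdiv s t)
  then show ?case using fiber_ldiv principal_ldiv by fastforce
next
  case (MRdiv s t)
  then show ?case using fiber_rdiv principal_rdiv by fastforce
qed (auto simp: point_def fiber_gen principal_unit single_in_principal)

lemma eval_mult_div_downset_alg_inject: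
  "eval_mult_div downset_alg point s = eval_mult_div downset_alg point t
    \<Longrightarrow> eval_mult_div B v s = eval_mult_div B v t"
  using eval_mult_div_downset_alg[of s] eval_mult_div_downset_alg[of t] principal_inject by auto

end

section \<open>Countable subalgebras\<close>

text \<open>The values of these terms form the subalgebra generated by the valuation, which is
  countable because the terms are.\<close>

datatype lattice_term =
    LVar nat
  | LLdiv lattice_term lattice_term
  | LRdiv lattice_term lattice_term
  | LUnit
  | LProd lattice_term lattice_term
  | LMeet lattice_term lattice_term
  | LJoin lattice_term lattice_term

instance lattice_term :: countable
  by countable_datatype

primrec eval_lattice ::
  "('a, 'm) lattice_div_alg_scheme \<Rightarrow> (nat \<Rightarrow> 'a) \<Rightarrow> lattice_term \<Rightarrow> 'a" where
  "eval_lattice A v (LVar n) = v n"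
| "eval_lattice A v (LLdiv s t) = eval_lattice A v s \<setminus>\<^bsub>A\<^esub> eval_lattice A v t"
| "eval_lattice A v (LRdiv s t) = eval_lattice A v s \<sslash>\<^bsub>A\<^esub> eval_lattice A v t"
| "eval_lattice A v LUnit = \<epsilon>\<^bsub>A\<^esub>"
| "eval_lattice A v (LProd s t) = eval_lattice A v s \<odot>\<^bsub>A\<^esub> eval_lattice A v t"
| "eval_lattice A v (LMeet s t) = eval_lattice A v s \<sqinter>\<^bsub>A\<^esub> eval_lattice A v t"
| "eval_lattice A v (LJoin s t) = eval_lattice A v s \<squnion>\<^bsub>A\<^esub> eval_lattice A v t"

text \<open>The algebra on \<open>C\<close> for which \<open>g\<close> is an isomorphism, with inverse \<open>f\<close>, onto a subalgebra of \<open>A\<close>.\<close>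

definition transport_alg ::
  "'b set \<Rightarrow> ('a \<Rightarrow> 'b) \<Rightarrow> ('b \<Rightarrow> 'a) \<Rightarrow> 'a lattice_div_alg \<Rightarrow> 'b lattice_div_alg" where
  "transport_alg C f g A = \<lparr>
    carrier = C,
    ldiv = (\<lambda>x y. f (g x \<setminus>\<^bsub>A\<^esub> g y)),
    rdiv = (\<lambda>x y. f (g x \<sslash>\<^bsub>A\<^esub> g y)),
    unit_elt = f \<epsilon>\<^bsub>A\<^esub>,
    prod_op = (\<lambda>x y. f (g x \<odot>\<^bsub>A\<^esub> g y)),
    meet_op = (\<lambda>x y. f (g x \<sqinter>\<^bsub>A\<^esub> g y)),
    join_op = (\<lambda>x y. f (g x \<squnion>\<^bsub>A\<^esub> g y))\<rparr>"

locale subalgebra_transport = integrally_closed_residuated_lattice A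
  for A :: "'a lattice_div_alg" (structure) +
  fixes C :: "'b set" and f :: "'a \<Rightarrow> 'b" and g :: "'b \<Rightarrow> 'a"
  assumes fg [simp]: "x \<in> C \<Longrightarrow> f (g x) = x"
    and g_carrier [simp]: "x \<in> C \<Longrightarrow> g x \<in> carrier A"
    and subalgebra:
      "\<And>x y. \<lbrakk>x \<in> C; y \<in> C\<rbrakk> \<Longrightarrow> g x \<setminus> g y \<in> g ` C"
      "\<And>x y. \<lbrakk>x \<in> C; y \<in> C\<rbrakk> \<Longrightarrow> g x \<sslash> g y \<in> g ` C"
      "\<epsilon> \<in> g ` C"
      "\<And>x y. \<lbrakk>x \<in> C; y \<in> C\<rbrakk> \<Longrightarrow> g x \<odot> g y \<in> g ` C"
      "\<And>x y. \<lbrakk>x \<in> C; y \<in> C\<rbrakk> \<Longrightarrow> g x \<sqinter> g y \<in> g ` C"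
      "\<And>x y. \<lbrakk>x \<in> C; y \<in> C\<rbrakk> \<Longrightarrow> g x \<squnion> g y \<in> g ` C"
begin

lemma f_closed: "x \<in> g ` C \<Longrightarrow> f x \<in> C" and gf: "x \<in> g ` C \<Longrightarrow> g (f x) = x"
  by auto

abbreviation T :: "'b lattice_div_alg" where "T \<equiv> transport_alg C f g A"

lemma carrier_T [simp]: "carrier T = C"
  by (simp add: transport_alg_def)

lemma T_closed [simp]:
  "\<lbrakk>x \<in> C; y \<in> C\<rbrakk> \<Longrightarrow> x \<setminus>\<^bsub>T\<^esub> y \<in> C" "\<lbrakk>x \<in> C; y \<in> C\<rbrakk> \<Longrightarrow> x \<sslash>\<^bsub>T\<^esub> y \<in> C"
  "\<epsilon>\<^bsub>T\<^esub> \<in> C" "\<lbrakk>x \<in> C; y \<in> C\<rbrakk> \<Longrightarrow> x \<odot>\<^bsub>T\<^esub> y \<in> C"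
  "\<lbrakk>x \<in> C; y \<in> C\<rbrakk> \<Longrightarrow> x \<sqinter>\<^bsub>T\<^esub> y \<in> C" "\<lbrakk>x \<in> C; y \<in> C\<rbrakk> \<Longrightarrow> x \<squnion>\<^bsub>T\<^esub> y \<in> C"
  using subalgebra f_closed by (simp_all add: transport_alg_def)

lemma g_T [simp]:
  "\<lbrakk>x \<in> C; y \<in> C\<rbrakk> \<Longrightarrow> g (x \<setminus>\<^bsub>T\<^esub> y) = g x \<setminus> g y"
  "\<lbrakk>x \<in> C; y \<in> C\<rbrakk> \<Longrightarrow> g (x \<sslash>\<^bsub>T\<^esub> y) = g x \<sslash> g y"
  "g \<epsilon>\<^bsub>T\<^esub> = \<epsilon>"
  "\<lbrakk>x \<in> C; y \<in> C\<rbrakk> \<Longrightarrow> g (x \<odot>\<^bsub>T\<^esub> y) = g x \<odot> g y"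
  "\<lbrakk>x \<in> C; y \<in> C\<rbrakk> \<Longrightarrow> g (x \<sqinter>\<^bsub>T\<^esub> y) = g x \<sqinter> g y"
  "\<lbrakk>x \<in> C; y \<in> C\<rbrakk> \<Longrightarrow> g (x \<squnion>\<^bsub>T\<^esub> y) = g x \<squnion> g y"
  using subalgebra gf by (simp_all add: transport_alg_def)

lemma eq_iff: "\<lbrakk>x \<in> C; y \<in> C\<rbrakk> \<Longrightarrow> x = y \<longleftrightarrow> g x = g y"
  using fg by metis

lemma le_T_iff: "\<lbrakk>x \<in> C; y \<in> C\<rbrakk> \<Longrightarrow> x \<sqsubseteq>\<^bsub>T\<^esub> y \<longleftrightarrow> g x \<sqsubseteq> g y"
  by (simp add: lattice_le_def eq_iff)

lemma transport_integrally_closed: "integrally_closed_residuated_lattice T"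
proof -
  interpret Group.monoid "monoid_reduct T"
    by (rule monoidI) (simp_all add: monoid_reduct_def eq_iff prod_assoc)
  show ?thesis
  proof unfold_locales
    fix a b c assume "a \<in> carrier T" "b \<in> carrier T" "c \<in> carrier T"
    then show "b \<sqsubseteq>\<^bsub>T\<^esub> a \<setminus>\<^bsub>T\<^esub> c \<longleftrightarrow> a \<odot>\<^bsub>T\<^esub> b \<sqsubseteq>\<^bsub>T\<^esub> c"
      and "a \<odot>\<^bsub>T\<^esub> b \<sqsubseteq>\<^bsub>T\<^esub> c \<longleftrightarrow> a \<sqsubseteq>\<^bsub>T\<^esub> c \<sslash>\<^bsub>T\<^esub> b"
      by (simp_all add: le_T_iff residuation_left residuation_right)
  next
    fix x y assume xy: "x \<in> carrier T" "y \<in> carrier T"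
    show "y \<sqsubseteq>\<^bsub>T\<^esub> \<epsilon>\<^bsub>T\<^esub>" if "x \<odot>\<^bsub>T\<^esub> y \<sqsubseteq>\<^bsub>T\<^esub> x"
      using that xy integrally_closed_right[of "g x" "g y"] by (simp add: le_T_iff)
    show "y \<sqsubseteq>\<^bsub>T\<^esub> \<epsilon>\<^bsub>T\<^esub>" if "y \<odot>\<^bsub>T\<^esub> x \<sqsubseteq>\<^bsub>T\<^esub> x"
      using that xy integrally_closed_left[of "g x" "g y"] by (simp add: le_T_iff)
  qed (simp_all add: eq_iff meet_comm join_comm meet_assoc join_assoc
      meet_join_absorb join_meet_absorb)
qed

lemma eval_div_T:
  assumes "range w \<subseteq> C"
  shows "eval_div T w t \<in> C \<and> g (eval_div T w t) = eval_div A (\<lambda>i. g (w i)) t"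
  using assms by (induction t) auto

lemma eval_mult_div_T:
  assumes "range w \<subseteq> C"
  shows "eval_mult_div T w t \<in> C \<and> g (eval_mult_div T w t) = eval_mult_div A (\<lambda>i. g (w i)) t"
  using assms by (induction t) auto

end

text \<open>\<open>downset_alg\<close> is uncountable, already because \<open>magnus\<close> is,
  while the target type is only known to be infinite. A refutation lives in the countable subalgebra
  generated by the valuation.\<close>

lemma generated_subalgebra_transport:
  fixes A :: "'a lattice_div_alg" (structure) and v :: "nat \<Rightarrow> 'a"
  assumes A: "integrally_closed_residuated_lattice A" and inf: "infinite (UNIV :: 'b set)"
    and v: "range v \<subseteq> carrier A"
  obtains C :: "'b set" and f g w where
    "subalgebra_transport A C f g" "range w \<subseteq> C" "\<And>i. g (w i) = v i"
proof -
  interpret integrally_closed_residuated_lattice A by (rule A)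
  define S where "S = range (eval_lattice A v)"
  have S: "S \<subseteq> carrier A"
  proof -
    have "eval_lattice A v t \<in> carrier A" for t
      using v by (induction t) (auto simp: meet_closed join_closed)
    then show ?thesis by (auto simp: S_def)
  qed
  obtain e :: "nat \<Rightarrow> 'b" where e: "inj e" using infinite_countable_subset[OF inf] by auto
  have "countable S" by (simp add: S_def)
  define f where "f x = e (to_nat_on S x)" for x
  have f: "inj_on f S"
    using e inj_on_to_nat_on[OF \<open>countable S\<close>] by (auto simp: f_def inj_on_def)
  define g where "g = inv_into S f"
  have gf: "g (f x) = x" if "x \<in> S" for x using f that by (simp add: g_def)
  have gC: "g x \<in> S" if "x \<in> f ` S" for x using gf that by auto
  have closed: "x \<in> g ` f ` S" if "x \<in> S" for x using gf that by (metis imageI)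
  have ops: "\<epsilon> \<in> S" "\<And>x y. x \<in> S \<Longrightarrow> y \<in> S \<Longrightarrow> x \<setminus> y \<in> S \<and> x \<sslash> y \<in> S \<and> x \<odot> y \<in> S
      \<and> x \<sqinter> y \<in> S \<and> x \<squnion> y \<in> S"
    unfolding S_def by (metis eval_lattice.simps(4) rangeI)
      (auto simp flip: eval_lattice.simps)
  have "subalgebra_transport A (f ` S) f g"
    using gC gf S ops closed by unfold_locales auto
  moreover have "v i \<in> S" for i unfolding S_def by (metis eval_lattice.simps(1) rangeI)
  then have "range (\<lambda>i. f (v i)) \<subseteq> f ` S" "\<And>i. g (f (v i)) = v i" using gf by auto
  ultimately show thesis by (rule that)
qed

section \<open>Reducts as records of the smaller signature\<close>

lemma eval_mult_div_truncate:
  "eval_mult_div (mult_div_alg.truncate A) v t = eval_mult_div A v t"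
  by (induction t) (simp_all add: mult_div_alg.truncate_def)

lemma eval_div_truncate: "eval_div (div_alg.truncate A) v t = eval_div A v t"
  by (induction t) (simp_all add: div_alg.truncate_def)

text \<open>The theorem quantifies over records with exactly the fields of the signature, so a
  residuated lattice has to be cut down before validity in its reduct can be invoked.\<close>

lemma pseudo_BCI_truncate:
  assumes "pseudo_BCI_algebra A"
  shows "pseudo_BCI_algebra (div_alg.truncate A)"
proof -
  interpret pseudo_BCI_algebra A by (rule assms)
  show ?thesis
    by unfold_locales (auto simp: div_alg.truncate_def ax_i ax_ii ax_iii ax_iv dest: ax_vi)
qed

lemma sirmonoid_truncate:
  assumes "\<exists>le. sirmonoid A le"
  shows "\<exists>le. sirmonoid (mult_div_alg.truncate A) le"
proof -
  have "pseudo_BCI_algebra A" using assms unfolding sirmonoid_iff_algebra by simp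
  then interpret pseudo_BCI_algebra A .
  have "pseudo_BCI_algebra (mult_div_alg.truncate A)"
    by unfold_locales (auto simp: mult_div_alg.truncate_def ax_i ax_ii ax_iii ax_iv dest: ax_vi)
  then show ?thesis
    using assms unfolding sirmonoid_iff_algebra by (simp add: mult_div_alg.truncate_def)
qed

theorem theorem4p7:
  assumes "infinite (UNIV :: 'a set)"
  shows
    "(\<forall>s t :: mult_div_term.
        (\<forall>A :: 'a lattice_div_alg.
           integrally_closed_residuated_lattice A \<longrightarrow> satisfies_mult_div A s t) \<longleftrightarrow>
        (\<forall>(S :: 'a mult_div_alg) le.
           sirmonoid S le \<longrightarrow> satisfies_mult_div S s t)) \<and>
     (\<forall>s t :: div_term.
        (\<forall>A :: 'a lattice_div_alg.
           integrally_closed_residuated_lattice A \<longrightarrow> satisfies_div A s t) \<longleftrightarrow>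
        (\<forall>B :: 'a div_alg.
           pseudo_BCI_algebra B \<longrightarrow> satisfies_div B s t))"
proof (intro conjI allI iffI impI)
  fix s t :: mult_div_term and A :: "'a lattice_div_alg"
  assume sir: "\<forall>(S :: 'a mult_div_alg) le. sirmonoid S le \<longrightarrow> satisfies_mult_div S s t"
    and A: "integrally_closed_residuated_lattice A"
  interpret integrally_closed_residuated_lattice A by (rule A)
  have "satisfies_mult_div (mult_div_alg.truncate A) s t"
    using sir sirmonoid_truncate[OF reduct_sirmonoid] by blast
  then show "satisfies_mult_div A s t"
    by (simp add: satisfies_mult_div_def eval_mult_div_truncate)
      (simp add: mult_div_alg.truncate_def)
next
  fix s t :: div_term and A :: "'a lattice_div_alg"
  assume bci: "\<forall>B :: 'a div_alg. pseudo_BCI_algebra B \<longrightarrow> satisfies_div B s t"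
    and A: "integrally_closed_residuated_lattice A"
  interpret integrally_closed_residuated_lattice A by (rule A)
  have "satisfies_div (div_alg.truncate A) s t"
    using bci pseudo_BCI_truncate[OF reduct_pseudo_BCI_algebra] by blast
  then show "satisfies_div A s t"
    by (simp add: satisfies_div_def eval_div_truncate) (simp add: div_alg.truncate_def)
next
  fix s t :: mult_div_term and S :: "'a mult_div_alg" and le
  assume icrl: "\<forall>A :: 'a lattice_div_alg.
      integrally_closed_residuated_lattice A \<longrightarrow> satisfies_mult_div A s t"
    and S: "sirmonoid S le"
  show "satisfies_mult_div S s t"
    unfolding satisfies_mult_div_def
  proof (intro allI impI)
    fix v :: "nat \<Rightarrow> 'a" assume v: "range v \<subseteq> carrier S"
    have S': "pseudo_BCI_algebra S" using sirmonoid.satisfies_axioms(1)[OF S] .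
    interpret sirmonoid_valuation S v
      using S' v sirmonoid.satisfies_axioms(2)[OF S] sirmonoid.prod_closed[OF S]
      by (auto simp: sirmonoid_valuation_def pseudo_BCI_valuation_def
          pseudo_BCI_valuation_axioms_def sirmonoid_valuation_axioms_def)
    obtain C :: "'a set" and f g w where T: "subalgebra_transport downset_alg C f g"
      and w: "range w \<subseteq> C" "\<And>i. g (w i) = point i"
      using generated_subalgebra_transport[OF downset_alg_integrally_closed assms point_closed]
      by blast
    interpret T: subalgebra_transport downset_alg C f g by (rule T)
    \<comment> \<open>The assumption speaks of algebras on \<open>'a\<close>, so it is applied to
      the copy \<open>T.T\<close>; the embedding \<open>g\<close> then carries the equation over to
      \<open>downset_alg\<close>.\<close>
    have "eval_mult_div T.T w s = eval_mult_div T.T w t"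
      using icrl T.transport_integrally_closed w(1) unfolding satisfies_mult_div_def by simp
    then have "eval_mult_div downset_alg point s = eval_mult_div downset_alg point t"
      using T.eval_mult_div_T[OF w(1)] by (metis w(2) ext)
    then show "eval_mult_div S v s = eval_mult_div S v t"
      by (rule eval_mult_div_downset_alg_inject)
  qed
next
  fix s t :: div_term and B :: "'a div_alg"
  assume icrl: "\<forall>A :: 'a lattice_div_alg.
      integrally_closed_residuated_lattice A \<longrightarrow> satisfies_div A s t"
    and B: "pseudo_BCI_algebra B"
  show "satisfies_div B s t"
    unfolding satisfies_div_def
  proof (intro allI impI)
    fix v :: "nat \<Rightarrow> 'a" assume v: "range v \<subseteq> carrier B"
    interpret pseudo_BCI_valuation B v
      using B v by (auto simp: pseudo_BCI_valuation_def pseudo_BCI_valuation_axioms_def)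
    obtain C :: "'a set" and f g w where T: "subalgebra_transport downset_alg C f g"
      and w: "range w \<subseteq> C" "\<And>i. g (w i) = point i"
      using generated_subalgebra_transport[OF downset_alg_integrally_closed assms point_closed]
      by blast
    interpret T: subalgebra_transport downset_alg C f g by (rule T)
    have "eval_div T.T w s = eval_div T.T w t"
      using icrl T.transport_integrally_closed w(1) unfolding satisfies_div_def by simp
    then have "eval_div downset_alg point s = eval_div downset_alg point t"
      using T.eval_div_T[OF w(1)] by (metis w(2) ext)
    then show "eval_div B v s = eval_div B v t"
      by (rule eval_div_downset_alg_inject)
  qed
qed

end
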